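(* There are absolute constants $c,K>0$ such that, for every integer $r\ge 2$ and every integer $k\ge 2$ with $k\ge K r^2\log^6(2r)$, one has $$R_r(k)\le \exp\!\left(-c\,\frac{k}{r^2\log^4(2r)}\right) r^{rk}.$$
   Context: For integers $r,k\ge 2$, $R_r(k)$ denotes the diagonal $r$-color Ramsey number: the least integer $n$ such that every coloring of the edges of $K_n$ with $r$ colors contains a monochromatic copy of $K_k$. All logarithms are natural, and $\log^a(x)=(\log x)^a$. *)

theory Defs
  imports Complex_Main "HOL-Library.Ramsey"
begin

text \<open>The predicate \<^const>\<open>partn\<close>, taken at \<open>{..<n}\<close>, \<open>k\<close>, \<open>2\<close>, \<open>{..<r}\<close>, says that every
  colouring of the edges of the complete graph on \<open>{..<n}\<close> by the colours in \<open>{..<r}\<close> has a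
  monochromatic complete subgraph on \<open>k\<close> vertices; not all \<open>r\<close> colours have to be used.\<close>

definition ramsey_number :: "nat \<Rightarrow> nat \<Rightarrow> nat" where
  "ramsey_number r k = (LEAST n. partn {..<n} k 2 {..<r})"

text \<open>By Ramsey's theorem the set minimised over is never empty.\<close>

lemma partn_eq_partn_lst_replicate:
  "partn {..<n::nat} k m {..<r::nat} \<longleftrightarrow> partn_lst {..<n} (replicate r k) m"
  by (simp add: partn_def partn_lst_def Bex_def cong: conj_cong)

lemma partn_ramsey_number: "partn {..<ramsey_number r k} k 2 {..<r}"
proof -
  have "\<exists>n::nat. partn {..<n} k 2 {..<r}"
    unfolding partn_eq_partn_lst_replicate by (rule ramsey_full)
  then show ?thesis
    unfolding ramsey_number_def by (rule LeastI_ex)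
qed

lemma ramsey_number_le_iff: "ramsey_number r k \<le> n \<longleftrightarrow> partn {..<n} k 2 {..<r}"
proof
  assume "ramsey_number r k \<le> n"
  with partn_ramsey_number show "partn {..<n} k 2 {..<r}"
    unfolding partn_eq_partn_lst_replicate by (rule partn_lst_greater_resource)
next
  assume "partn {..<n} k 2 {..<r}"
  then show "ramsey_number r k \<le> n"
    unfolding ramsey_number_def by (rule Least_le)
qed

end

theory Submission
  imports Defs
begin

text \<open>The book algorithm of Balister, Bollobas, Campos, Griffiths, Hurley, Morris, Sahasrabudhe and
  Tiba is run with a sharper geometric lemma. All mixed moments of
  inner-product kernels \<open>x\<^sub>1, \<dots>, x\<^sub>r\<close> at independent points are nonnegative, so for a function
  \<open>h \<ge> 0\<close> with nonnegative coefficients and \<open>h 0 = 1\<close> we have \<open>E \<Prod>\<^sub>i h(x\<^sub>i) \<ge> 1\<close>. If moreover \<open>h\<close> on \<open>x \<le> -1\<close> is at most \<open>1/(2r)\<close> times its even part,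
  then replacing \<open>h(x\<^sub>j)\<close> by the even part shows that the event \<open>x\<^sub>j \<le> -1\<close> carries at most \<open>1/(2r)\<close> of the
  mass, and half of the mass lies where all \<open>x\<^sub>i > -1\<close>. A product with zeros of even multiplicity \<open>O(log r)\<close>
  at \<open>-1, -2, -4, \<dots>\<close> has this property and grows only like \<open>exp (O(log r (log x)\<^sup>2))\<close>. Hence a step of the
  algorithm that tolerates inner products up to \<open>r log\<^sup>4 r\<close> costs a factor \<open>exp (O(r log\<^sup>3 r))\<close>
  only, which allows monochromatic books with a spine of order \<open>k / (r log\<^sup>2 r)\<close>.\<close>

section \<open>Positive kernels\<close>

text \<open>A book with a spine of \<open>t\<close> vertices in colour \<open>j\<close> lowers the
  target of that colour by \<open>t\<close> and costs a factor of about r^t in the number of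
  vertices, which is just what the uniform Erdos-Szekeres bound charges for these vertices. So a
  book by itself gains nothing. The gain comes from tilting the weights afterwards: colour
  \<open>j\<close>, where at most k - t vertices are still wanted, gets weight (1 - \<theta>)/r and
  the other colours slightly more than 1/r. To first order this gains t\<theta> in the exponent and
  to second order it loses about k\<theta>^2, so \<theta> is of order t/k and the gain of order
  t^2/k. With t of order k/(r log^2 r) this is the k/(r^2 log^4 r) of the theorem. All other losses
  must stay below t^2/k, that is, below order t/(r log^2 r). One of them comes from the density
  boosts: each costs the page set a further factor of about r, that is, log r in the exponent. As
  the density cannot exceed 1, boosts that each raise its excess by a factor of at least 1 + 2^s/t
  are O(t log r / 2^s) in number when 2^s \<le> t. This is why inner products up to order r log^4 r
  must be tolerated without a boost, and why t has to be at least of this order, which is the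
  condition on k.\<close>

inductive pos_kernel :: "('a \<Rightarrow> 'a \<Rightarrow> real) \<Rightarrow> bool" where
  rank_one: "pos_kernel (\<lambda>u v. f u * f v)"
| add: "pos_kernel K \<Longrightarrow> pos_kernel L \<Longrightarrow> pos_kernel (\<lambda>u v. K u v + L u v)"

lemma pos_kernel_sum_nonneg:
  assumes "pos_kernel K"
  shows "0 \<le> (\<Sum>u\<in>X. \<Sum>v\<in>X. K u v)"
  using assms
proof induction
  case (rank_one f)
  have "(\<Sum>u\<in>X. \<Sum>v\<in>X. f u * f v) = (\<Sum>u\<in>X. f u) * (\<Sum>v\<in>X. f v)"
    by (simp add: sum_product)
  then show ?case by simp
qed (simp add: sum.distrib)

lemma pos_kernel_const: "0 \<le> a \<Longrightarrow> pos_kernel (\<lambda>u v. a)"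
  using pos_kernel.rank_one[of "\<lambda>_. sqrt a"] by simp

text \<open>A product of two rank-one kernels has rank one, so the Schur product theorem is mere
  bilinearity here. This is the advantage of generating the kernels from rank-one ones over defining
  them by semidefiniteness.\<close>

lemma pos_kernel_mult:
  assumes "pos_kernel K" "pos_kernel L"
  shows "pos_kernel (\<lambda>u v. K u v * L u v)"
  using assms
proof induction
  case (rank_one f)
  from rank_one show ?case
  proof induction
    case (rank_one g)
    show ?case
      using pos_kernel.rank_one[of "\<lambda>u. f u * g u"] by (simp add: ac_simps)
  next
    case (add K L)
    show ?case
      unfolding distrib_left by (intro pos_kernel.add add.IH)
  qed
next
  case (add K K')
  then show ?case
    unfolding distrib_right by (intro pos_kernel.add)
qed

lemma pos_kernel_scale: "0 \<le> a \<Longrightarrow> pos_kernel K \<Longrightarrow> pos_kernel (\<lambda>u v. a * K u v)"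
  by (rule pos_kernel_mult[OF pos_kernel_const])

lemma pos_kernel_sum:
  assumes "finite I" "\<And>i. i \<in> I \<Longrightarrow> pos_kernel (K i)"
  shows "pos_kernel (\<lambda>u v. \<Sum>i\<in>I. K i u v)"
  using assms by (induction I) (auto intro: pos_kernel_const pos_kernel.add)

section \<open>Functions that preserve positivity, separated into even and odd part\<close>

definition pos_even :: "(real \<Rightarrow> real) \<Rightarrow> real \<Rightarrow> real" where
  "pos_even h x = (h x + h (- x)) / 2"

definition pos_odd :: "(real \<Rightarrow> real) \<Rightarrow> real \<Rightarrow> real" where
  "pos_odd h x = (h x - h (- x)) / 2"

text \<open>Stands in for "power series with nonnegative coefficients and constant term at least 1",
  without any series. The two parts are kept apart because the geometric lemma compares
  \<open>h\<close> with its even part. The \<open>TYPE\<close> argument fixes the type of the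
  points, which does not occur in the type of \<open>h\<close>.\<close>

definition kernel_map :: "'a itself \<Rightarrow> (real \<Rightarrow> real) \<Rightarrow> bool" where
  "kernel_map _ h \<longleftrightarrow> (\<forall>K :: 'a \<Rightarrow> 'a \<Rightarrow> real. pos_kernel K \<longrightarrow>
     pos_kernel (\<lambda>u v. pos_even h (K u v) - 1) \<and> pos_kernel (\<lambda>u v. pos_odd h (K u v)))"

lemma kernel_map_linear:
  assumes "0 \<le> a"
  shows "kernel_map TYPE('a) (\<lambda>x. 1 + a * x)"
  unfolding kernel_map_def
proof (intro allI impI)
  fix K :: "'a \<Rightarrow> 'a \<Rightarrow> real"
  assume "pos_kernel K"
  then show "pos_kernel (\<lambda>u v. pos_even (\<lambda>x. 1 + a * x) (K u v) - 1)
      \<and> pos_kernel (\<lambda>u v. pos_odd (\<lambda>x. 1 + a * x) (K u v))"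
    using pos_kernel_const[of 0] pos_kernel_scale[OF assms, of K]
    by (simp add: pos_even_def pos_odd_def)
qed

text \<open>The even part of a product is even times even plus odd times odd, and the odd part
  consists of the mixed products. \<open>e\<close> and \<open>o\<close> rewrite both in terms of the
  even parts minus 1, after which only plus signs occur.\<close>

lemma kernel_map_mult:
  assumes "kernel_map TYPE('a) f" "kernel_map TYPE('a) g"
  shows "kernel_map TYPE('a) (\<lambda>x. f x * g x)"
  unfolding kernel_map_def
proof (intro allI impI)
  fix K :: "'a \<Rightarrow> 'a \<Rightarrow> real"
  assume "pos_kernel K"
  then have fe: "pos_kernel (\<lambda>u v. pos_even f (K u v) - 1)"
    and fo: "pos_kernel (\<lambda>u v. pos_odd f (K u v))"
    and ge: "pos_kernel (\<lambda>u v. pos_even g (K u v) - 1)"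
    and go: "pos_kernel (\<lambda>u v. pos_odd g (K u v))"
    using assms by (auto simp: kernel_map_def)
  have e: "pos_even (\<lambda>x. f x * g x) y - 1 =
      (pos_even f y - 1) * (pos_even g y - 1) + (pos_even f y - 1) + (pos_even g y - 1)
      + pos_odd f y * pos_odd g y" for y
    by (simp add: pos_even_def pos_odd_def field_simps)
  have o: "pos_odd (\<lambda>x. f x * g x) y =
      (pos_even f y - 1) * pos_odd g y + pos_odd g y + (pos_even g y - 1) * pos_odd f y
      + pos_odd f y" for y
    by (simp add: pos_even_def pos_odd_def field_simps)
  show "pos_kernel (\<lambda>u v. pos_even (\<lambda>x. f x * g x) (K u v) - 1) \<and>
        pos_kernel (\<lambda>u v. pos_odd (\<lambda>x. f x * g x) (K u v))"
    unfolding e o using fe fo ge go by (intro conjI pos_kernel.add pos_kernel_mult)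
qed

lemma kernel_map_one: "kernel_map TYPE('a) (\<lambda>x. 1)"
  using kernel_map_linear[of 0] by simp

lemma kernel_map_power: "kernel_map TYPE('a) f \<Longrightarrow> kernel_map TYPE('a) (\<lambda>x. f x ^ n)"
  by (induction n) (auto intro: kernel_map_one kernel_map_mult)

lemma kernel_map_prod:
  assumes "finite I" "\<And>i. i \<in> I \<Longrightarrow> kernel_map TYPE('a) (f i)"
  shows "kernel_map TYPE('a) (\<lambda>x. \<Prod>i\<in>I. f i x)"
  using assms by (induction I) (auto intro: kernel_map_one kernel_map_mult)

lemma pos_kernel_map_minus_one:
  assumes "kernel_map TYPE('a) h" "pos_kernel (K :: 'a \<Rightarrow> 'a \<Rightarrow> real)"
  shows "pos_kernel (\<lambda>u v. h (K u v) - 1)"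
proof -
  have "h y - 1 = (pos_even h y - 1) + pos_odd h y" for y
    by (simp add: pos_even_def pos_odd_def field_simps)
  moreover have "pos_kernel (\<lambda>u v. (pos_even h (K u v) - 1) + pos_odd h (K u v))"
    using assms unfolding kernel_map_def by (intro pos_kernel.add) auto
  ultimately show ?thesis by presburger
qed

text \<open>Keeping track of the excess over 1, rather than of positivity alone, is what later
  bounds the average of the product below by 1 and not just by 0.\<close>

lemma pos_kernel_prod_minus_one:
  assumes "finite I" "\<And>i. i \<in> I \<Longrightarrow> pos_kernel (\<lambda>u v. K i u v - 1)"
  shows "pos_kernel (\<lambda>u v. (\<Prod>i\<in>I. K i u v) - 1)"
  using assms
proof (induction I)
  case (insert j I)
  have e: "a * b - 1 = (a - 1) * (b - 1) + (a - 1) + (b - 1)" for a b :: real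
    by (simp add: algebra_simps)
  have "pos_kernel (\<lambda>u v. K j u v * (\<Prod>i\<in>I. K i u v) - 1)"
    unfolding e using insert by (intro pos_kernel.add pos_kernel_mult) auto
  then show ?case using insert by simp
qed (simp add: pos_kernel_const)

lemma pos_kernel_of_minus_one:
  assumes "pos_kernel (\<lambda>u v. K u v - 1)"
  shows "pos_kernel K"
  using pos_kernel.add[OF assms pos_kernel_const[of 1]] by simp

text \<open>The zeros at \<open>-2\<^sup>m\<close> make \<open>dyadic M (-y)\<close> much smaller than \<open>dyadic M y\<close> at every scale
  \<open>1 \<le> y \<le> 2\<^sup>M\<close>, while the growth \<open>2\<close> to the power \<open>O((log y)\<^sup>2)\<close> is far below that of
  \<open>exp (sqrt y)\<close>, the minimum for a function with nonnegative coefficients that is bounded on the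
  negative axis.\<close>

definition dyadic :: "nat \<Rightarrow> real \<Rightarrow> real" where
  "dyadic M x = (\<Prod>m\<le>M. 1 + x / 2 ^ m)"

lemma kernel_map_dyadic: "kernel_map TYPE('a) (\<lambda>x. dyadic M x ^ n)"
  unfolding dyadic_def
  using kernel_map_linear[of "1 / 2 ^ m" for m]
  by (intro kernel_map_power kernel_map_prod) simp_all

lemma dyadic_nonneg: "-1 \<le> x \<Longrightarrow> 0 \<le> dyadic M x"
  unfolding dyadic_def
proof (intro prod_nonneg ballI)
  fix m assume x: "-1 \<le> x"
  have "(1::real) \<le> 2 ^ m" by simp
  with x have "-(2 ^ m) \<le> x" by linarith
  then show "0 \<le> 1 + x / 2 ^ m" by (simp add: field_simps)
qed

lemma dyadic_mono:
  assumes "-1 \<le> x" "x \<le> y"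
  shows "dyadic M x \<le> dyadic M y"
  unfolding dyadic_def
proof (intro prod_mono conjI)
  fix m
  have "(1::real) \<le> 2 ^ m" by simp
  with assms have "-(2 ^ m) \<le> x" by linarith
  then show "0 \<le> 1 + x / 2 ^ m" by (simp add: field_simps)
  show "1 + x / 2 ^ m \<le> 1 + y / 2 ^ m"
    using assms by (simp add: divide_right_mono)
qed

lemma dyadic_one_le: "dyadic M 1 \<le> 16"
proof -
  have "dyadic M 1 \<le> (\<Prod>m\<le>M. exp (1 / 2 ^ m))"
    unfolding dyadic_def by (intro prod_mono) auto
  also have "\<dots> = exp (\<Sum>m\<le>M. (1/2) ^ m)"
    by (simp add: exp_sum power_divide)
  also have "(\<Sum>m\<le>M. (1/2::real) ^ m) \<le> 2"
    by (simp add: sum_gp0)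
  also have "exp (2::real) \<le> 16"
  proof -
    have "exp (2::real) = exp 1 * exp 1" by (simp flip: exp_add)
    also have "\<dots> \<le> 3 * 3"
      using exp_le by (intro mult_mono) auto
    finally show ?thesis by simp
  qed
  finally show ?thesis by simp
qed

text \<open>Doubling the argument shifts the factors by one index: \<open>1 + 2 * x\<close> enters
  in front, and the factor that falls out at the end is at least 1.\<close>

lemma dyadic_double:
  assumes "0 \<le> x"
  shows "dyadic M (2 * x) \<le> (1 + 2 * x) * dyadic M x"
proof (cases M)
  case (Suc M')
  have "dyadic M (2 * x) = (1 + 2 * x) * (\<Prod>m\<le>M'. 1 + x / 2 ^ m)"
    unfolding dyadic_def Suc prod.atMost_Suc_shift by simp
  also have "\<dots> \<le> (1 + 2 * x) * ((\<Prod>m\<le>M'. 1 + x / 2 ^ m) * (1 + x / 2 ^ M))"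
  proof (intro mult_left_mono)
    have "0 \<le> (\<Prod>m\<le>M'. 1 + x / 2 ^ m)" using assms by (intro prod_nonneg) auto
    moreover have "1 \<le> 1 + x / 2 ^ M" using assms by simp
    ultimately have "(\<Prod>m\<le>M'. 1 + x / 2 ^ m) * 1 \<le> (\<Prod>m\<le>M'. 1 + x / 2 ^ m) * (1 + x / 2 ^ M)"
      by (intro mult_left_mono)
    then show "(\<Prod>m\<le>M'. 1 + x / 2 ^ m) \<le> (\<Prod>m\<le>M'. 1 + x / 2 ^ m) * (1 + x / 2 ^ M)"
      by simp
  qed (use assms in simp)
  also have "\<dots> = (1 + 2 * x) * dyadic M x"
    by (simp add: dyadic_def Suc)
  finally show ?thesis .
qed (use assms in \<open>simp add: dyadic_def\<close>)

text \<open>Each doubling costs a factor of at most \<open>2 ^ (s + 2)\<close>, so the exponent is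
  quadratic in \<open>s\<close>. It matters that the bound is uniform in \<open>M\<close>, because
  \<open>M\<close> will depend on the set of points.\<close>

lemma dyadic_bound:
  assumes "-1 \<le> x" "x \<le> 2 ^ s"
  shows "dyadic M x \<le> 2 ^ ((s + 2) ^ 2)"
proof -
  have "dyadic M (2 ^ s) \<le> 2 ^ ((s + 2) ^ 2)"
  proof (induction s)
    case 0
    have "((0::nat) + 2)\<^sup>2 = 4" by (simp add: power2_eq_square)
    then show ?case using dyadic_one_le[of M] by simp
  next
    case (Suc s)
    have "dyadic M (2 ^ Suc s) \<le> (1 + 2 ^ Suc s) * dyadic M (2 ^ s)"
      using dyadic_double[of "2 ^ s" M] by simp
    also have "\<dots> \<le> 2 ^ (s + 2) * 2 ^ ((s + 2) ^ 2)"
    proof (intro mult_mono Suc.IH)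
      have "(1::real) \<le> 2 ^ Suc s" by (rule one_le_power) simp
      then show "1 + 2 ^ Suc s \<le> (2::real) ^ (s + 2)" by simp
      show "0 \<le> dyadic M (2 ^ s)" by (rule dyadic_nonneg) (simp add: order_trans[of _ 0])
    qed auto
    also have "\<dots> \<le> 2 ^ ((Suc s + 2) ^ 2)"
      unfolding power_add[symmetric]
      by (rule power_increasing) (auto simp: power2_eq_square algebra_simps)
    finally show ?case .
  qed
  with dyadic_mono[OF assms, of M] show ?thesis by linarith
qed

text \<open>A single factor suffices. If \<open>y\<close> lies between \<open>2 ^ m\<close> and
  \<open>2 ^ Suc m\<close>, the factor with zero at \<open>-(2 ^ m)\<close> shrinks at least
  threefold in absolute value when \<open>y\<close> is replaced by \<open>- y\<close>, and no other
  factor grows.\<close>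

lemma dyadic_reflect:
  assumes "1 \<le> y" "y \<le> 2 ^ M"
  shows "3 * \<bar>dyadic M (- y)\<bar> \<le> dyadic M y"
proof -
  obtain m where m: "m \<le> M" "2 ^ m \<le> y" "y \<le> 2 ^ Suc m"
  proof -
    define m where "m = (GREATEST m. 2 ^ m \<le> y)"
    have bd: "n \<le> M" if "2 ^ n \<le> y" for n
    proof -
      have "(2::real) ^ n \<le> 2 ^ M" using that assms by linarith
      then show ?thesis by (simp add: power_le_imp_le_exp)
    qed
    have m1: "2 ^ m \<le> y"
      unfolding m_def by (rule GreatestI_nat[of _ 0 M]) (use assms bd in auto)
    have "\<not> 2 ^ Suc m \<le> y"
    proof
      assume "2 ^ Suc m \<le> y"
      then have "Suc m \<le> m"
        unfolding m_def by (rule Greatest_le_nat) (use bd in auto)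
      then show False by simp
    qed
    then show ?thesis using that[of m] m1 bd[OF m1] by simp
  qed
  have split: "{..M} = insert m ({..M} - {m})" using m by auto
  have d: "dyadic M x = (1 + x / 2 ^ m) * (\<Prod>n\<in>{..M} - {m}. 1 + x / 2 ^ n)" for x
    unfolding dyadic_def by (subst split, subst prod.insert) auto
  have "3 * \<bar>1 + - y / 2 ^ m\<bar> \<le> 1 + y / 2 ^ m"
    using m by (auto simp: abs_if field_simps)
  moreover have "\<bar>\<Prod>n\<in>{..M} - {m}. 1 + - y / 2 ^ n\<bar> \<le> (\<Prod>n\<in>{..M} - {m}. 1 + y / 2 ^ n)"
    unfolding abs_prod using assms
    by (intro prod_mono) (auto simp: abs_if)
  ultimately have "(3 * \<bar>1 + - y / 2 ^ m\<bar>) * \<bar>\<Prod>n\<in>{..M} - {m}. 1 + - y / 2 ^ n\<bar>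
      \<le> (1 + y / 2 ^ m) * (\<Prod>n\<in>{..M} - {m}. 1 + y / 2 ^ n)"
    using assms by (intro mult_mono) auto
  then show ?thesis unfolding d abs_mult by (simp add: mult.assoc)
qed

section \<open>The geometric lemma\<close>

text \<open>The even exponent makes the function nonnegative everywhere and turns the ratio 3 into
  9^k. Of the constant 4, one factor 2 pays for the halving in \<open>pos_even\<close>.\<close>

lemma dyadic_power_le_even:
  assumes y: "y \<le> -1" "\<bar>y\<bar> \<le> 2 ^ M" and k: "4 * real r \<le> 9 ^ k"
  shows "2 * real r * dyadic M y ^ (2 * k) \<le> pos_even (\<lambda>x. dyadic M x ^ (2 * k)) y"
proof -
  have "3 * \<bar>dyadic M y\<bar> \<le> dyadic M (- y)"
    using dyadic_reflect[of "- y" M] y by simp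
  then have "(3 * \<bar>dyadic M y\<bar>) ^ (2 * k) \<le> dyadic M (- y) ^ (2 * k)"
    by (rule power_mono) simp
  then have *: "9 ^ k * dyadic M y ^ (2 * k) \<le> dyadic M (- y) ^ (2 * k)"
    by (simp add: power_mult power_mult_distrib)
  have "4 * real r * dyadic M y ^ (2 * k) \<le> 9 ^ k * dyadic M y ^ (2 * k)"
    using k by (intro mult_right_mono) auto
  moreover have "0 \<le> dyadic M y ^ (2 * k)" by simp
  ultimately have "4 * real r * dyadic M y ^ (2 * k)
      \<le> dyadic M y ^ (2 * k) + dyadic M (- y) ^ (2 * k)"
    using * by linarith
  then show ?thesis unfolding pos_even_def by (simp add: mult.assoc)
qed

lemma dyadic_power_mass:
  fixes x :: "nat \<Rightarrow> 'a \<Rightarrow> 'a \<Rightarrow> real"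
  assumes ker: "\<And>i. i < r \<Longrightarrow> pos_kernel (x i)"
    and bd: "\<And>i u v. i < r \<Longrightarrow> u \<in> X \<Longrightarrow> v \<in> X \<Longrightarrow> \<bar>x i u v\<bar> \<le> 2 ^ M"
    and r: "0 < r" and k: "4 * real r \<le> 9 ^ k"
  shows "real (card X) ^ 2 / 2 \<le> (\<Sum>u\<in>X. \<Sum>v\<in>X.
           of_bool (\<forall>i<r. -1 < x i u v) * (\<Prod>i<r. dyadic M (x i u v) ^ (2 * k)))"
    (is "_ \<le> ?G")
proof -
  define h where "h = (\<lambda>y. dyadic M y ^ (2 * k))"
  define P where "P u v = (\<Prod>i<r. h (x i u v))" for u v
  define R where "R j u v = (\<Prod>i\<in>{..<r} - {j}. h (x i u v))" for j u v
  define Q where "Q j u v = pos_even h (x j u v) * R j u v" for j u v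
  define S where "S = (\<Sum>u\<in>X. \<Sum>v\<in>X. P u v)"
  have hmap: "kernel_map TYPE('a) h"
    unfolding h_def by (rule kernel_map_dyadic)
  have h0: "0 \<le> h y" for y by (simp add: h_def)
  have e0: "0 \<le> pos_even h y" for y using h0[of y] h0[of "-y"] by (simp add: pos_even_def)
  have R0: "0 \<le> R j u v" for j u v unfolding R_def by (intro prod_nonneg) (simp add: h0)
  have P_split: "P u v = h (x j u v) * R j u v" if "j < r" for j u v
    unfolding P_def R_def using that by (intro prod.remove) auto
  have P1: "pos_kernel (\<lambda>u v. P u v - 1)"
    unfolding P_def using hmap ker by (intro pos_kernel_prod_minus_one pos_kernel_map_minus_one) auto
  have "0 \<le> (\<Sum>u\<in>X. \<Sum>v\<in>X. P u v - 1)" by (rule pos_kernel_sum_nonneg[OF P1])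
  then have S1: "real (card X) ^ 2 \<le> S"
    by (simp add: sum_subtractf S_def power2_eq_square)
  \<comment> \<open>The difference \<open>P - Q j\<close> is the odd part of \<open>h (x j)\<close>
    times the remaining factors, hence a positive kernel.\<close>
  have QS: "(\<Sum>u\<in>X. \<Sum>v\<in>X. Q j u v) \<le> S" if "j < r" for j
  proof -
    have "pos_kernel (R j)"
      unfolding R_def[abs_def] using hmap ker
      by (intro pos_kernel_prod_minus_one[THEN pos_kernel_of_minus_one] pos_kernel_map_minus_one) auto
    moreover have "pos_kernel (\<lambda>u v. pos_odd h (x j u v))"
      using hmap ker[OF that] unfolding kernel_map_def by blast
    ultimately have "pos_kernel (\<lambda>u v. pos_odd h (x j u v) * R j u v)"
      by (rule pos_kernel_mult[rotated])
    then have "0 \<le> (\<Sum>u\<in>X. \<Sum>v\<in>X. pos_odd h (x j u v) * R j u v)"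
      by (rule pos_kernel_sum_nonneg)
    moreover have "pos_odd h (x j u v) * R j u v = P u v - Q j u v" for u v
      unfolding P_split[OF that] Q_def by (simp add: pos_odd_def pos_even_def field_simps)
    ultimately show ?thesis by (simp add: sum_subtractf S_def)
  qed
  \<comment> \<open>Several colours may be bad at the same pair, but the terms \<open>Q j\<close>
    are nonnegative, so summing over all \<open>j\<close> is safe. After summation over pairs the
    \<open>r\<close> terms cost at most S/(2r) each and half of \<open>S\<close> survives.\<close>
  have pt: "P u v \<le> of_bool (\<forall>i<r. -1 < x i u v) * P u v + (\<Sum>j<r. Q j u v / (2 * real r))"
    if "u \<in> X" "v \<in> X" for u v
  proof (cases "\<forall>i<r. -1 < x i u v")
    case True
    have "0 \<le> (\<Sum>j<r. Q j u v / (2 * real r))"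
      unfolding Q_def using e0 R0 by (intro sum_nonneg) simp
    with True show ?thesis by simp
  next
    case False
    then obtain j where j: "j < r" "x j u v \<le> -1" by force
    have "2 * real r * h (x j u v) \<le> pos_even h (x j u v)"
      unfolding h_def using dyadic_power_le_even[OF j(2) bd[OF j(1) that] k] by simp
    then have "2 * real r * h (x j u v) * R j u v \<le> Q j u v"
      unfolding Q_def using R0 by (intro mult_right_mono) auto
    then have "P u v \<le> Q j u v / (2 * real r)"
      unfolding P_split[OF j(1)] using r by (simp add: field_simps)
    also have "\<dots> \<le> (\<Sum>j<r. Q j u v / (2 * real r))"
      using j e0 R0 by (intro member_le_sum) (auto simp: Q_def)
    finally have "P u v \<le> (\<Sum>j<r. Q j u v / (2 * real r))" .
    moreover have "of_bool (\<forall>i<r. -1 < x i u v) * P u v = 0" using False by simp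
    ultimately show ?thesis by linarith
  qed
  have "S \<le> (\<Sum>u\<in>X. \<Sum>v\<in>X. of_bool (\<forall>i<r. -1 < x i u v) * P u v + (\<Sum>j<r. Q j u v / (2 * real r)))"
    unfolding S_def by (intro sum_mono pt)
  also have "\<dots> = ?G + (\<Sum>u\<in>X. \<Sum>v\<in>X. \<Sum>j<r. Q j u v / (2 * real r))"
    by (simp add: sum.distrib P_def h_def)
  also have "(\<Sum>u\<in>X. \<Sum>v\<in>X. \<Sum>j<r. Q j u v / (2 * real r))
      = (\<Sum>u\<in>X. \<Sum>j<r. \<Sum>v\<in>X. Q j u v / (2 * real r))"
    by (rule sum.cong[OF refl], rule sum.swap)
  also have "\<dots> = (\<Sum>j<r. (\<Sum>u\<in>X. \<Sum>v\<in>X. Q j u v) / (2 * real r))"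
    by (subst sum.swap) (simp add: sum_divide_distrib)
  also have "\<dots> \<le> (\<Sum>j<r. S / (2 * real r))"
    using QS by (intro sum_mono divide_right_mono) auto
  also have "\<dots> = S / 2" using r by simp
  finally show ?thesis using S1 by simp
qed

section \<open>From weighted mass to one vertex with many good partners\<close>

lemma sum_half_powers_le: "(\<Sum>s\<in>{a..<b}. (1/2::real) ^ (s + 3)) \<le> 1/4"
proof -
  have "(\<Sum>s\<in>{a..<b}. (1/2::real) ^ (s + 3)) \<le> (\<Sum>s<b. (1/2::real) ^ (s + 3))"
    by (intro sum_mono2) auto
  also have "\<dots> = (1 - (1/2) ^ b) / 4"
    by (induction b) (simp_all add: power_add field_simps)
  also have "\<dots> \<le> 1/4" by simp
  finally show ?thesis .
qed

lemma two_power_half_power: "2 ^ n * (1/2::real) ^ n = 1"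
  by (simp flip: power_mult_distrib)

lemma two_power_half_power_3: "2 ^ (2 * n) * (1/2::real) ^ (3 * n) = (1/2) ^ n"
proof -
  have "3 * n = 2 * n + n" by simp
  then show ?thesis
    unfolding power_add[of "1/2::real" "2 * n" n, symmetric]
    by (metis mult.assoc mult_1 power_add two_power_half_power)
qed

lemma exists_row:
  fixes C :: "'a \<Rightarrow> 'a \<Rightarrow> bool"
  assumes "finite X" "X \<noteq> {}"
    and "\<beta> * real (card X) ^ 2 \<le> (\<Sum>u\<in>X. \<Sum>v\<in>X. of_bool (C u v))"
  shows "\<exists>u\<in>X. \<beta> * real (card X) \<le> real (card {v \<in> X. C u v})"
proof (rule ccontr)
  assume "\<not> ?thesis"
  then have "\<And>u. u \<in> X \<Longrightarrow> real (card {v \<in> X. C u v}) < \<beta> * real (card X)" by force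
  then have "(\<Sum>u\<in>X. real (card {v \<in> X. C u v})) < (\<Sum>u\<in>X. \<beta> * real (card X))"
    using assms by (intro sum_strict_mono) auto
  moreover have "(\<Sum>v\<in>X. of_bool (C u v)) = real (card {v \<in> X. C u v})" for u
    using assms(1) by (simp add: Collect_conj_eq Int_commute)
  ultimately show False using assms by (simp add: power2_eq_square algebra_simps)
qed

text \<open>If both alternatives fail for every vertex, all the relevant sets of pairs are so sparse
  that their total weight drops below half of the square of \<open>card X\<close>, against
  \<open>dyadic_power_mass\<close>. Where all inner products lie between -1 and
  \<open>2 ^ s\<close>, the weight has exponent \<open>2 * k * r * (s + 2)\<^sup>2\<close>. The
  sparsity has coefficient 3 instead of 2, and the surplus pays for the sum over the
  \<open>r\<close> colours and all scales.\<close>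

lemma kernel_dichotomy:
  fixes x :: "nat \<Rightarrow> 'a \<Rightarrow> 'a \<Rightarrow> real"
  assumes ker: "\<And>i. i < r \<Longrightarrow> pos_kernel (x i)"
    and X: "finite X" "X \<noteq> {}" and r: "0 < r" and k: "4 * real r \<le> 9 ^ k"
  obtains
    (balanced) u where "u \<in> X"
      "(1/2) ^ (3 * k * r * (s0 + 2)\<^sup>2) * real (card X)
        \<le> real (card {v \<in> X. \<forall>i<r. -1 \<le> x i u v})"
  | (boost) u i s where "u \<in> X" "i < r" "s0 \<le> s"
      "(1/2) ^ (3 * k * r * (s + 3)\<^sup>2) * real (card X) \<le> real (card {v \<in> X. 2 ^ s \<le> x i u v})"
proof (rule ccontr)
  assume no: "\<not> thesis"
  define N where "N = real (card X) ^ 2"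
  have N: "0 < N" using X by (simp add: N_def card_gt_0_iff)
  have k0: "0 < k" using k r by (cases k) auto
  obtain M where M: "s0 < M" "\<And>i u v. i < r \<Longrightarrow> u \<in> X \<Longrightarrow> v \<in> X \<Longrightarrow> \<bar>x i u v\<bar> \<le> 2 ^ M"
  proof -
    define m where "m = Max ((\<lambda>(i,u,v). \<bar>x i u v\<bar>) ` ({..<r} \<times> X \<times> X))"
    obtain n where n: "m < 2 ^ n" using real_arch_pow[of 2 m] by auto
    have "\<bar>x i u v\<bar> \<le> 2 ^ (n + s0 + 1)" if "i < r" "u \<in> X" "v \<in> X" for i u v
    proof -
      have "\<bar>x i u v\<bar> \<le> m"
        unfolding m_def using that X by (intro Max_ge) (auto intro!: image_eqI[of _ _ "(i,u,v)"])
      also have "m \<le> 2 ^ n" using n by simp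
      also have "(2::real) ^ n \<le> 2 ^ (n + s0 + 1)" by (rule power_increasing) auto
      finally show ?thesis .
    qed
    then show ?thesis using that[of "n + s0 + 1"] by auto
  qed
  \<comment> \<open>The cap \<open>2 ^ s0\<close> is what bounds the weight on these pairs by
    \<open>H s0\<close>; the alternative \<open>balanced\<close> forgets it again.\<close>
  define A where "A = (\<Sum>u\<in>X. \<Sum>v\<in>X. of_bool (\<forall>i<r. -1 \<le> x i u v \<and> x i u v \<le> 2 ^ s0) :: real)"
  define B where "B i s = (\<Sum>u\<in>X. \<Sum>v\<in>X. of_bool (2 ^ s \<le> x i u v) :: real)" for i s
  define H where "H s = (2::real) ^ (2 * k * r * (s + 2)\<^sup>2)" for s
  have A: "A < (1/2) ^ (3 * k * r * (s0 + 2)\<^sup>2) * N"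
  proof (rule ccontr)
    assume "\<not> ?thesis"
    then obtain u where u: "u \<in> X" "(1/2) ^ (3 * k * r * (s0 + 2)\<^sup>2) * real (card X) \<le>
        real (card {v \<in> X. \<forall>i<r. -1 \<le> x i u v \<and> x i u v \<le> 2 ^ s0})"
      using exists_row[OF X, of "(1/2) ^ (3 * k * r * (s0 + 2)\<^sup>2)"
          "\<lambda>u v. \<forall>i<r. -1 \<le> x i u v \<and> x i u v \<le> 2 ^ s0"]
      unfolding A_def N_def not_less by blast
    have "card {v \<in> X. \<forall>i<r. -1 \<le> x i u v \<and> x i u v \<le> 2 ^ s0} \<le> card {v \<in> X. \<forall>i<r. -1 \<le> x i u v}"
      using X by (intro card_mono) auto
    with u have "(1/2) ^ (3 * k * r * (s0 + 2)\<^sup>2) * real (card X) \<le>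
        real (card {v \<in> X. \<forall>i<r. -1 \<le> x i u v})"
      by linarith
    with balanced u no show False by blast
  qed
  have B: "B i s < (1/2) ^ (3 * k * r * (s + 3)\<^sup>2) * N" if "i < r" "s0 \<le> s" for i s
  proof (rule ccontr)
    assume "\<not> ?thesis"
    then obtain u where "u \<in> X" "(1/2) ^ (3 * k * r * (s + 3)\<^sup>2) * real (card X) \<le>
        real (card {v \<in> X. 2 ^ s \<le> x i u v})"
      using exists_row[OF X, of "(1/2) ^ (3 * k * r * (s + 3)\<^sup>2)" "\<lambda>u v. 2 ^ s \<le> x i u v"]
      unfolding B_def N_def not_less by blast
    with boost that no show False by blast
  qed
  have prod_le: "(\<Prod>i<r. dyadic M (x i u v) ^ (2 * k)) \<le> H s"
    if "\<forall>i<r. -1 < x i u v" "\<forall>i<r. x i u v \<le> 2 ^ s" for u v s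
  proof -
    have "(\<Prod>i<r. dyadic M (x i u v) ^ (2 * k)) \<le> (\<Prod>i<r. (2 ^ ((s + 2)\<^sup>2)) ^ (2 * k))"
    proof (intro prod_mono conjI power_mono)
      fix i assume "i \<in> {..<r}"
      with that have "-1 \<le> x i u v" "x i u v \<le> 2 ^ s" by (auto simp: less_imp_le)
      then show "dyadic M (x i u v) \<le> 2 ^ (s + 2)\<^sup>2" "0 \<le> dyadic M (x i u v)"
        by (rule dyadic_bound, intro dyadic_nonneg)
      then show "0 \<le> dyadic M (x i u v) ^ (2 * k)" by simp
    qed
    also have "\<dots> = H s" by (simp add: H_def ac_simps flip: power_mult)
    finally show ?thesis .
  qed
  have H0: "0 \<le> H s" for s by (simp add: H_def)
  have pt: "of_bool (\<forall>i<r. -1 < x i u v) * (\<Prod>i<r. dyadic M (x i u v) ^ (2 * k))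
      \<le> H s0 * of_bool (\<forall>i<r. -1 \<le> x i u v \<and> x i u v \<le> 2 ^ s0)
        + (\<Sum>s\<in>{s0..<M}. \<Sum>i<r. H (Suc s) * of_bool (2 ^ s \<le> x i u v))" (is "?l \<le> ?a + ?b")
    if uv: "u \<in> X" "v \<in> X" for u v
  proof (cases "\<forall>i<r. -1 < x i u v")
    case gt: True
    have b0: "0 \<le> ?b" using H0 by (intro sum_nonneg) auto
    have l: "?l = (\<Prod>i<r. dyadic M (x i u v) ^ (2 * k))"
      using gt by simp
    show ?thesis
    proof (cases "\<forall>i<r. x i u v \<le> 2 ^ s0")
      case True
      with gt have "\<forall>i<r. -1 \<le> x i u v \<and> x i u v \<le> 2 ^ s0" by (meson less_imp_le)
      then have "?a = H s0" by simp
      with prod_le[OF gt True] l b0 show ?thesis by linarith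
    next
      case False
      define T where "T s \<longleftrightarrow> (\<forall>i<r. x i u v \<le> 2 ^ s)" for s
      \<comment> \<open>The least dyadic scale dominating all colours. When it exceeds
        \<open>s0\<close>, minimality yields a colour that is at least \<open>2 ^ (s - 1)\<close>,
        and the indicator of that event carries the weight \<open>H s\<close>.\<close>
      define s where "s = (LEAST s. T s)"
      have ex: "T M"
        unfolding T_def using M(2)[OF _ uv] by (meson abs_ge_self order_trans)
      have s: "\<forall>i<r. x i u v \<le> 2 ^ s"
        using LeastI[of T, OF ex] by (simp add: s_def[symmetric]) (simp add: T_def)
      have sM: "s \<le> M" using Least_le[of T, OF ex] unfolding s_def .
      have ss: "s0 < s"
      proof (rule ccontr)
        assume "\<not> s0 < s"
        then have "(2::real) ^ s \<le> 2 ^ s0" by (intro power_increasing) auto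
        with s have "\<forall>i<r. x i u v \<le> 2 ^ s0" by (meson order_trans)
        with False show False by simp
      qed
      then obtain s' where s': "s = Suc s'" by (cases s) auto
      then have "\<not> (\<forall>i<r. x i u v \<le> 2 ^ s')"
        using not_less_Least[of s' T] by (simp add: s_def[symmetric]) (simp add: T_def)
      then obtain i where i: "i < r" "2 ^ s' \<le> x i u v" by force
      have "?l \<le> H (Suc s')" using prod_le[OF gt s] unfolding l s' .
      also have "\<dots> = H (Suc s') * of_bool (2 ^ s' \<le> x i u v)" using i by simp
      also have "\<dots> \<le> (\<Sum>i<r. H (Suc s') * of_bool (2 ^ s' \<le> x i u v))"
        by (rule member_le_sum[where f = "\<lambda>i. H (Suc s') * of_bool (2 ^ s' \<le> x i u v)"])
           (use i H0 in simp_all)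
      also have "\<dots> \<le> ?b"
        by (rule member_le_sum[where f = "\<lambda>s. \<Sum>i<r. H (Suc s) * of_bool (2 ^ s \<le> x i u v)"])
           (use ss sM s' H0 in \<open>auto intro!: sum_nonneg\<close>)
      finally have "?l \<le> ?b" .
      moreover have "0 \<le> ?a" using H0[of s0] by simp
      ultimately show ?thesis by linarith
    qed
  next
    case False
    have "?l = 0" using False by simp
    moreover have "0 \<le> ?a" "0 \<le> ?b" using H0 by (auto intro!: sum_nonneg)
    ultimately show ?thesis by linarith
  qed
  have "N / 2 \<le> (\<Sum>u\<in>X. \<Sum>v\<in>X. of_bool (\<forall>i<r. -1 < x i u v) *
      (\<Prod>i<r. dyadic M (x i u v) ^ (2 * k)))"
    unfolding N_def using ker M(2) r k by (rule dyadic_power_mass)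
  also have "\<dots> \<le> (\<Sum>u\<in>X. \<Sum>v\<in>X. H s0 * of_bool (\<forall>i<r. -1 \<le> x i u v \<and> x i u v \<le> 2 ^ s0)
        + (\<Sum>s\<in>{s0..<M}. \<Sum>i<r. H (Suc s) * of_bool (2 ^ s \<le> x i u v)))"
    by (intro sum_mono pt)
  also have "\<dots> = H s0 * A + (\<Sum>u\<in>X. \<Sum>v\<in>X. \<Sum>s\<in>{s0..<M}. \<Sum>i<r. H (Suc s) * of_bool (2 ^ s \<le> x i u v))"
    by (simp add: sum.distrib A_def sum_distrib_left)
  also have "(\<Sum>u\<in>X. \<Sum>v\<in>X. \<Sum>s\<in>{s0..<M}. \<Sum>i<r. H (Suc s) * of_bool (2 ^ s \<le> x i u v))
      = (\<Sum>s\<in>{s0..<M}. \<Sum>i<r. \<Sum>u\<in>X. \<Sum>v\<in>X. H (Suc s) * of_bool (2 ^ s \<le> x i u v))"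
    by (simp only: sum.swap[of _ "{s0..<M}" X] sum.swap[of _ "{..<r}" X])
  also have "\<dots> = (\<Sum>s\<in>{s0..<M}. \<Sum>i<r. H (Suc s) * B i s)"
    by (simp add: B_def sum_distrib_left)
  also have "\<dots> \<le> (\<Sum>s\<in>{s0..<M}. (1/2) ^ (s + 3) * N)"
  proof (intro sum_mono)
    fix s assume s: "s \<in> {s0..<M}"
    define e where "e = k * r * (s + 3)\<^sup>2"
    have "(\<Sum>i<r. H (Suc s) * B i s) \<le> (\<Sum>i<r. H (Suc s) * ((1/2) ^ (3 * k * r * (s + 3)\<^sup>2) * N))"
      using B s H0 by (intro sum_mono mult_left_mono) (auto simp: less_imp_le)
    also have "\<dots> = real r * (2 ^ (2 * e) * (1/2) ^ (3 * e)) * N"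
    proof -
      have "2 * k * r * (Suc s + 2)\<^sup>2 = 2 * e" "3 * k * r * (s + 3)\<^sup>2 = 3 * e"
        by (simp_all add: e_def)
      then show ?thesis by (simp only: H_def sum_constant card_lessThan mult.assoc)
    qed
    also have "2 ^ (2 * e) * (1/2) ^ (3 * e) = (1/2::real) ^ e"
      by (rule two_power_half_power_3)
    also have "real r * (1/2) ^ e * N \<le> (2 ^ r * (1/2) ^ (r + (s + 3))) * N"
    proof (intro mult_right_mono mult_mono)
      have "r + (s + 3) \<le> r * (s + 3) ^ 2"
      proof -
        define a where "a = r * (s + 3)"
        have "1 * (s + 3) \<le> a" "r * 1 \<le> a"
          unfolding a_def using r by (intro mult_le_mono; simp)+
        then have "r + (s + 3) \<le> a * 2" by simp
        also have "\<dots> \<le> a * (s + 3)" by (intro mult_le_mono) auto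
        also have "\<dots> = r * (s + 3)\<^sup>2" by (simp only: a_def power2_eq_square mult.assoc)
        finally show ?thesis .
      qed
      also have "\<dots> \<le> e" unfolding e_def using k0 by simp
      finally show "(1/2::real) ^ e \<le> (1/2) ^ (r + (s + 3))" by (rule power_decreasing) auto
      show "real r \<le> 2 ^ r" using of_nat_less_two_power[of r] by (rule less_imp_le)
    qed (use N in simp_all)
    also have "2 ^ r * (1/2) ^ (r + (s + 3)) = (1/2::real) ^ (s + 3)"
      unfolding power_add mult.assoc[symmetric] two_power_half_power by simp
    finally show "(\<Sum>i<r. H (Suc s) * B i s) \<le> (1/2) ^ (s + 3) * N" .
  qed
  also have "\<dots> \<le> 1/4 * N"
    unfolding sum_distrib_right[symmetric] using N by (intro mult_right_mono sum_half_powers_le) simp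
  finally have *: "N / 2 \<le> H s0 * A + 1/4 * N" by simp
  have "H s0 * A < H s0 * ((1/2) ^ (3 * k * r * (s0 + 2)\<^sup>2) * N)"
    using A by (intro mult_strict_left_mono) (auto simp: H_def)
  also have "\<dots> = (1/2) ^ (k * r * (s0 + 2)\<^sup>2) * N"
  proof -
    define e where "e = k * r * (s0 + 2)\<^sup>2"
    have e: "2 * k * r * (s0 + 2)\<^sup>2 = 2 * e" "3 * k * r * (s0 + 2)\<^sup>2 = 3 * e"
      by (simp_all add: e_def)
    show ?thesis
      unfolding H_def e e_def[symmetric] mult.assoc[symmetric] two_power_half_power_3 ..
  qed
  also have "\<dots> \<le> (1/2) ^ 2 * N"
  proof (intro mult_right_mono power_decreasing)
    have "(2::nat) \<le> 1 * 1 * 2 ^ 2" by simp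
    also have "\<dots> \<le> k * r * (s0 + 2)\<^sup>2" using k0 r by (intro mult_le_mono power_mono) auto
    finally show "2 \<le> k * r * (s0 + 2)\<^sup>2" .
  qed (use N in auto)
  finally have "H s0 * A < 1/4 * N" by (simp add: power2_eq_square)
  with * show False by linarith
qed

text \<open>The kernel is a scaled Gram matrix of the centred indicators of the sets
  \<open>Z u\<close>. All these sets have exactly \<open>n\<close> elements, so the cross terms are
  constant and the inner product becomes an affine function of the codegree.\<close>

lemma density_kernel:
  assumes Y: "finite Y" "Y \<noteq> {}" and n: "0 < n" and \<alpha>: "0 < (\<alpha>::real)"
    and Z: "\<And>u. u \<in> X \<Longrightarrow> Z u \<subseteq> Y \<and> card (Z u) = n"
  obtains K :: "'a \<Rightarrow> 'a \<Rightarrow> real" where "pos_kernel K"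
    "\<And>u v. u \<in> X \<Longrightarrow> v \<in> X \<Longrightarrow> K u v = (real (card (Z u \<inter> Z v)) / n - n / card Y) / \<alpha>"
proof
  define p where "p = real n / card Y"
  define f where "f y u = of_bool (y \<in> Z u) - p" for y u
  define K where "K u v = 1 / (\<alpha> * n) * (\<Sum>y\<in>Y. f y u * f y v)" for u v
  show "pos_kernel K"
    unfolding K_def[abs_def] using \<alpha> Y
    by (intro pos_kernel_scale pos_kernel_sum pos_kernel.rank_one) auto
  fix u v assume uv: "u \<in> X" "v \<in> X"
  have Yc: "real (card Y) > 0" using Y by (simp add: card_gt_0_iff)
  have c: "(\<Sum>y\<in>Y. of_bool (y \<in> Z u)) = real n" if "u \<in> X" for u
    using Z[OF that] Y by (simp add: Int_absorb1)
  have "(\<Sum>y\<in>Y. f y u * f y v) = (\<Sum>y\<in>Y. of_bool (y \<in> Z u \<inter> Z v)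
      - p * of_bool (y \<in> Z u) - p * of_bool (y \<in> Z v) + p * p)"
    unfolding f_def by (intro sum.cong) (auto simp: algebra_simps)
  also have "\<dots> = (\<Sum>y\<in>Y. of_bool (y \<in> Z u \<inter> Z v)) - p * (\<Sum>y\<in>Y. of_bool (y \<in> Z u))
      - p * (\<Sum>y\<in>Y. of_bool (y \<in> Z v)) + (\<Sum>y\<in>Y. p * p)"
    by (simp only: sum.distrib sum_subtractf sum_distrib_left)
  also have "(\<Sum>y\<in>Y. of_bool (y \<in> Z u \<inter> Z v)) = real (card (Z u \<inter> Z v))"
  proof -
    have "Y \<inter> (Z u \<inter> Z v) = Z u \<inter> Z v" using Z[OF uv(1)] by auto
    then show ?thesis using Y by (simp add: of_bool_conj Int_assoc)
  qed
  finally have "(\<Sum>y\<in>Y. f y u * f y v) = card (Z u \<inter> Z v) - p * n - p * n + card Y * (p * p)"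
    using c uv by simp
  also have "card Y * (p * p) = p * n" using Yc by (simp add: p_def)
  finally show "K u v = (real (card (Z u \<inter> Z v)) / n - n / card Y) / \<alpha>"
    using n \<alpha> unfolding K_def p_def[symmetric] by (simp add: field_simps)
qed

section \<open>Codegrees in all colours at once\<close>

definition nbhd :: "('a \<Rightarrow> 'a \<Rightarrow> nat) \<Rightarrow> nat \<Rightarrow> 'a \<Rightarrow> 'a set" where
  "nbhd c i x = {y. y \<noteq> x \<and> c x y = i}"

definition mono_clique :: "('a \<Rightarrow> 'a \<Rightarrow> nat) \<Rightarrow> nat \<Rightarrow> 'a set \<Rightarrow> bool" where
  "mono_clique c i S \<longleftrightarrow> (\<forall>x\<in>S. \<forall>y\<in>S. x \<noteq> y \<longrightarrow> c x y = i)"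

text \<open>A kernel value of at least \<beta> means that the codegree density exceeds its random
  value by \<beta> times \<open>\<alpha> i\<close>. The algorithm takes \<open>\<alpha> i\<close> to
  be a 1/t share of the current density excess, so that -1 is an affordable loss and
  \<open>2 ^ s\<close> is a relative gain of 2^s/t.\<close>

lemma common_neighbour_dichotomy:
  fixes Z :: "nat \<Rightarrow> 'a \<Rightarrow> 'a set" and \<alpha> :: "nat \<Rightarrow> real"
  assumes X: "finite X" "X \<noteq> {}" and r: "0 < r" and k: "4 * real r \<le> 9 ^ k"
    and Y: "\<And>i. i < r \<Longrightarrow> finite (Y i) \<and> Y i \<noteq> {}"
    and n: "\<And>i. i < r \<Longrightarrow> 0 < n i" and \<alpha>: "\<And>i. i < r \<Longrightarrow> 0 < \<alpha> i"
    and Z: "\<And>i u. i < r \<Longrightarrow> u \<in> X \<Longrightarrow> Z i u \<subseteq> Y i \<and> card (Z i u) = n i"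
  obtains
    (balanced) u X' where "u \<in> X" "X' \<subseteq> X"
      "(1/2) ^ (3 * k * r * (s0 + 2)\<^sup>2) * real (card X) \<le> real (card X')"
      "\<And>i v. i < r \<Longrightarrow> v \<in> X' \<Longrightarrow>
        (real (n i) / card (Y i) - \<alpha> i) * n i \<le> card (Z i u \<inter> Z i v)"
  | (boost) u i s X' where "u \<in> X" "i < r" "s0 \<le> s" "X' \<subseteq> X"
      "(1/2) ^ (3 * k * r * (s + 3)\<^sup>2) * real (card X) \<le> real (card X')"
      "\<And>v. v \<in> X' \<Longrightarrow>
        (real (n i) / card (Y i) + 2 ^ s * \<alpha> i) * n i \<le> card (Z i u \<inter> Z i v)"
proof -
  have "\<forall>i. \<exists>K. i < r \<longrightarrow> pos_kernel K \<and> (\<forall>u\<in>X. \<forall>v\<in>X.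
     K u v = (real (card (Z i u \<inter> Z i v)) / n i - n i / card (Y i)) / \<alpha> i)"
  proof
    fix i
    show "\<exists>K. i < r \<longrightarrow> pos_kernel K \<and> (\<forall>u\<in>X. \<forall>v\<in>X.
       K u v = (real (card (Z i u \<inter> Z i v)) / n i - n i / card (Y i)) / \<alpha> i)"
    proof (cases "i < r")
      case True
      obtain K where "pos_kernel K" "\<And>u v. u \<in> X \<Longrightarrow> v \<in> X \<Longrightarrow>
          K u v = (real (card (Z i u \<inter> Z i v)) / n i - n i / card (Y i)) / \<alpha> i"
        using density_kernel[of "Y i" "n i" "\<alpha> i" X "Z i"] Y[OF True] n[OF True] \<alpha>[OF True] Z[OF True]
        by blast
      then show ?thesis by blast
    qed simp
  qed
  then obtain K where K: "\<And>i. i < r \<Longrightarrow> pos_kernel (K i)"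
      "\<And>i u v. i < r \<Longrightarrow> u \<in> X \<Longrightarrow> v \<in> X \<Longrightarrow>
        K i u v = (real (card (Z i u \<inter> Z i v)) / n i - n i / card (Y i)) / \<alpha> i"
    by metis
  have le: "(real (n i) / card (Y i) + \<beta> * \<alpha> i) * n i \<le> card (Z i u \<inter> Z i v)"
    if "\<beta> \<le> K i u v" "i < r" "u \<in> X" "v \<in> X" for i u v \<beta>
    using that(1) n[OF that(2)] \<alpha>[OF that(2)] unfolding K(2)[OF that(2-4)]
    by (simp add: field_simps)
  show thesis
  proof (rule kernel_dichotomy[of r K X k s0, OF K(1) X r k])
    fix u
    assume u: "u \<in> X" and "(1/2) ^ (3 * k * r * (s0 + 2)\<^sup>2) * real (card X)
        \<le> real (card {v \<in> X. \<forall>i<r. -1 \<le> K i u v})"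
    then show thesis
      using le[of "-1" _ u] by (intro balanced[of u "{v \<in> X. \<forall>i<r. -1 \<le> K i u v}"]) auto
  next
    fix u i s
    assume "u \<in> X" "i < r" "s0 \<le> s" "(1/2) ^ (3 * k * r * (s + 3)\<^sup>2) * real (card X)
        \<le> real (card {v \<in> X. 2 ^ s \<le> K i u v})"
    then show thesis
      using le[of "2 ^ s" i u] by (intro boost[of u i s "{v \<in> X. 2 ^ s \<le> K i u v}"]) auto
  qed
qed

section \<open>The book algorithm\<close>

text \<open>Up to \<open>t\<close> losses by a factor 1 - 1/t leave a constant share of the density
  excess. The number 9 bounds e^2 and is the source of every later 9 / \<delta>.\<close>

lemma power_one_minus_inverse_ge:
  assumes "2 \<le> t" "n \<le> t"
  shows "1 / 9 \<le> (1 - 1 / real t) ^ n"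
proof -
  have "(1 + 1 / real (t - 1)) ^ t \<le> exp (1 / real (t - 1)) ^ t"
    by (intro power_mono) auto
  also have "\<dots> = exp (real t / real (t - 1))" by (simp flip: exp_of_nat_mult)
  also have "\<dots> \<le> exp (1 + 1)"
  proof -
    have "real t / real (t - 1) \<le> 1 + 1" using assms by (simp add: field_simps of_nat_diff)
    then show ?thesis by (rule exp_le_cancel_iff[THEN iffD2])
  qed
  also have "\<dots> \<le> 3 * 3" unfolding exp_add using exp_le by (intro mult_mono) auto
  finally have "(1 + 1 / real (t - 1)) ^ t \<le> 9" by simp
  moreover have "(1 - 1 / real t) ^ t * (1 + 1 / real (t - 1)) ^ t = 1"
    unfolding power_mult_distrib[symmetric] using assms by (simp add: field_simps of_nat_diff)
  moreover have t0: "0 \<le> 1 - 1 / real t" using assms by simp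
  ultimately have "1 \<le> (1 - 1 / real t) ^ t * 9"
    by (metis mult_left_mono zero_le_power)
  moreover have "(1 - 1 / real t) ^ t \<le> (1 - 1 / real t) ^ n"
    using assms t0 by (intro power_decreasing) auto
  ultimately show ?thesis by simp
qed

text \<open>Here \<open>k\<close> is half the multiplicity of the zeros of the test function, not a
  clique size. \<open>G\<close> is the price, in the logarithm of the size of the reservoir
  \<open>X\<close>, of raising the logarithm of a density excess by 1. Beyond the range of scales in
  \<open>cost\<close> a boost would push a density above 1. The exponent in \<open>size\<close> pays
  for \<open>r * t\<close> colour steps and for all boosts that can ever occur.\<close>

locale book_setup =
  fixes c :: "'a \<Rightarrow> 'a \<Rightarrow> nat" and r t s0 k :: nat and p0 \<delta> G :: real
    and X0 :: "'a set" and Y0 :: "nat \<Rightarrow> 'a set"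
  assumes sym: "c x y = c y x" and col: "c x y < r"
    and r: "0 < r" and t: "2 \<le> t" and k: "4 * real r \<le> 9 ^ k" and \<delta>: "0 < \<delta>" "\<delta> < p0" and G: "0 \<le> G"
    and fin: "finite X0" "i < r \<Longrightarrow> finite (Y0 i)" and Y0: "i < r \<Longrightarrow> Y0 i \<noteq> {}"
    and deg: "i < r \<Longrightarrow> x \<in> X0 \<Longrightarrow> p0 * card (Y0 i) \<le> card (nbhd c i x \<inter> Y0 i)"
    and cost: "s0 \<le> s \<Longrightarrow> 2 ^ s \<le> 9 * real t / \<delta> \<Longrightarrow>
      real (3 * k * r * (s + 3)\<^sup>2) * ln 2 \<le> G * ln (1 + 2 ^ s / real t)"
    and size: "exp ((ln (2 * real r) + real (3 * k * r * (s0 + 2)\<^sup>2) * ln 2) * (real r * real t)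
      + G * (real r * ln (9 / \<delta>))) \<le> card X0"
begin

text \<open>The price of one colour step: the balanced alternative of the dichotomy, and a factor 2r
  for passing to the most frequent colour at the chosen vertex.\<close>

definition a :: real where
  "a = ln (2 * real r) + real (3 * k * r * (s0 + 2)\<^sup>2) * ln 2"

text \<open>The guaranteed excess of a density over p0 - \<delta>. It starts at \<delta>, a colour
  step multiplies it by 1 - 1/t and a boost at scale \<open>s\<close> by 1 + 2^s/t. Being
  multiplicative, it never reaches 0.\<close>

definition z :: "nat \<Rightarrow> real \<Rightarrow> real" where
  "z n l = \<delta> * (1 - 1 / real t) ^ n * exp l"

text \<open>The set \<open>S\<close> is the clique of colour \<open>i\<close> built so far, \<open>b\<close> counts the density boosts of colour
  \<open>i\<close>, and \<open>l\<close> is the sum of \<open>ln (1 + 2\<^sup>s / t)\<close> over these boosts.\<close>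

definition colour_inv :: "'a set \<Rightarrow> nat \<Rightarrow> 'a set \<Rightarrow> 'a set \<Rightarrow> nat \<Rightarrow> real \<Rightarrow> bool" where
  "colour_inv X i S Y b l \<longleftrightarrow> finite S \<and> card S \<le> t \<and> mono_clique c i S \<and> S \<subseteq> X0 \<and>
    (\<forall>x\<in>S. X \<subseteq> nbhd c i x) \<and> (\<forall>x\<in>S. Y \<subseteq> nbhd c i x) \<and> Y \<subseteq> Y0 i \<and> Y \<noteq> {} \<and>
    (p0 - \<delta>) ^ (card S + b) * card (Y0 i) \<le> card Y \<and>
    (\<forall>x\<in>X. (p0 - \<delta> + z (card S) l) * card Y \<le> card (nbhd c i x \<inter> Y)) \<and>
    real b * ln (1 + 2 ^ s0 / real t) \<le> l"

definition inv :: "'a set \<Rightarrow> (nat \<Rightarrow> 'a set) \<Rightarrow> (nat \<Rightarrow> 'a set) \<Rightarrow> (nat \<Rightarrow> nat) \<Rightarrow> (nat \<Rightarrow> real) \<Rightarrow> bool"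
  where "inv X Y T B L \<longleftrightarrow> X \<subseteq> X0 \<and> X \<noteq> {} \<and> (\<forall>i<r. colour_inv X i (T i) (Y i) (B i) (L i)) \<and>
    card X0 * exp (- a * (\<Sum>i<r. real (card (T i))) - G * (\<Sum>i<r. L i)) \<le> card X"

lemma colour_inv_mono: "colour_inv X i S Y b l \<Longrightarrow> X' \<subseteq> X \<Longrightarrow> colour_inv X' i S Y b l"
  unfolding colour_inv_def by blast

lemma z_ge:
  assumes "n \<le> t"
  shows "\<delta> / 9 * exp l \<le> z n l"
proof -
  have "\<delta> * (1 / 9) \<le> \<delta> * (1 - 1 / real t) ^ n"
    using power_one_minus_inverse_ge[OF t assms] \<delta> by (intro mult_left_mono) auto
  then show ?thesis unfolding z_def by (intro mult_right_mono) auto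
qed

lemma boost_unit_pos: "0 < ln (1 + 2 ^ s / real t)"
  using t by (intro ln_gt_zero) simp

text \<open>No density exceeds 1, so the excess, which is at least \<delta>/9 times exp (L i), stays
  below 1. This caps the total effect of the boosts in each colour, both for termination and for the
  final loss.\<close>

lemma L_bounds:
  assumes inv: "inv X Y T B L" and i: "i < r"
  shows "0 \<le> L i" "L i \<le> ln (9 / \<delta>)"
proof -
  have ci: "colour_inv X i (T i) (Y i) (B i) (L i)" and "X \<noteq> {}"
    using inv i by (auto simp: inv_def)
  then obtain x where x: "x \<in> X" by auto
  have "0 \<le> real (B i) * ln (1 + 2 ^ s0 / real t)" using boost_unit_pos by (simp add: less_imp_le)
  then show "0 \<le> L i" using ci unfolding colour_inv_def by linarith
  have fY: "finite (Y i)" using ci fin(2)[OF i] unfolding colour_inv_def by (meson finite_subset)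
  have Y: "Y i \<noteq> {}" using ci by (simp add: colour_inv_def)
  have "(p0 - \<delta> + z (card (T i)) (L i)) * card (Y i) \<le> card (nbhd c i x \<inter> Y i)"
    using ci x by (simp add: colour_inv_def)
  also have "\<dots> \<le> 1 * real (card (Y i))" using fY by (simp add: card_mono)
  finally have "p0 - \<delta> + z (card (T i)) (L i) \<le> 1"
    using Y fY by (simp add: mult_le_cancel_right card_gt_0_iff)
  then have "z (card (T i)) (L i) \<le> 1" using \<delta> by simp
  moreover have "card (T i) \<le> t" using ci by (simp add: colour_inv_def)
  ultimately have "\<delta> / 9 * exp (L i) \<le> 1" using z_ge[of "card (T i)" "L i"] by linarith
  then have "exp (L i) \<le> 9 / \<delta>" using \<delta> by (simp add: field_simps)
  then show "L i \<le> ln (9 / \<delta>)" using \<delta> by (subst ln_ge_iff) auto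
qed

lemma half_power_eq_exp: "(1/2) ^ n = exp (- (real n * ln 2))"
  by (simp add: exp_minus exp_of_nat_mult power_one_over inverse_eq_divide)

lemma color_step_loss: "2 * real r * exp (- a) = (1/2) ^ (3 * k * r * (s0 + 2)\<^sup>2)"
  unfolding half_power_eq_exp a_def using r by (simp add: exp_diff exp_minus field_simps exp_add)

section \<open>The two moves of the algorithm\<close>

lemma inv_colour_step:
  assumes inv: "inv X Y T B L" and j: "j < r" and u: "u \<in> X" and Tj: "card (T j) < t"
    and X': "X' \<subseteq> X" "X' \<subseteq> nbhd c j u" "X' \<noteq> {}" "exp (- a) * card X \<le> card X'"
    and Y': "Y' \<subseteq> Y j" "Y' \<subseteq> nbhd c j u" "Y' \<noteq> {}" "(p0 - \<delta>) * card (Y j) \<le> card Y'"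
    and d: "\<And>v. v \<in> X' \<Longrightarrow>
      (p0 - \<delta> + z (Suc (card (T j))) (L j)) * card Y' \<le> card (nbhd c j v \<inter> Y')"
  shows "inv X' (Y(j := Y')) (T(j := insert u (T j))) B L" and "u \<notin> T j"
proof -
  have XX: "X \<subseteq> X0" "\<And>i. i < r \<Longrightarrow> colour_inv X i (T i) (Y i) (B i) (L i)"
      "card X0 * exp (- a * (\<Sum>i<r. real (card (T i))) - G * (\<Sum>i<r. L i)) \<le> card X"
    using inv by (auto simp: inv_def)
  have fT: "finite (T j)" and T: "mono_clique c j (T j)" "T j \<subseteq> X0"
      "\<And>x. x \<in> T j \<Longrightarrow> X \<subseteq> nbhd c j x" "\<And>x. x \<in> T j \<Longrightarrow> Y j \<subseteq> nbhd c j x"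
    and YY: "Y j \<subseteq> Y0 j" "(p0 - \<delta>) ^ (card (T j) + B j) * card (Y0 j) \<le> card (Y j)"
    and L: "real (B j) * ln (1 + 2 ^ s0 / real t) \<le> L j"
    using XX(2)[OF j] unfolding colour_inv_def by auto
  show uT: "u \<notin> T j" using T(3)[of u] u by (auto simp: nbhd_def)
  have sz: "(\<Sum>i<r. real (card ((T(j := insert u (T j))) i))) = (\<Sum>i<r. real (card (T i))) + 1"
    using j uT fT by (simp add: sum.remove[of "{..<r}" j])
  have "card X0 * exp (- a * ((\<Sum>i<r. real (card (T i))) + 1) - G * (\<Sum>i<r. L i))
      = exp (- a) * (card X0 * exp (- a * (\<Sum>i<r. real (card (T i))) - G * (\<Sum>i<r. L i)))"
    by (simp add: algebra_simps flip: exp_add)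
  also have "\<dots> \<le> exp (- a) * card X" using XX by (intro mult_left_mono) auto
  also have "\<dots> \<le> card X'" by (rule X')
  finally have X'c: "card X0 * exp (- a * ((\<Sum>i<r. real (card (T i))) + 1) - G * (\<Sum>i<r. L i)) \<le> card X'" .
  have "(p0 - \<delta>) ^ (Suc (card (T j)) + B j) * card (Y0 j)
      = (p0 - \<delta>) * ((p0 - \<delta>) ^ (card (T j) + B j) * card (Y0 j))" by simp
  also have "\<dots> \<le> (p0 - \<delta>) * card (Y j)" using YY \<delta> by (intro mult_left_mono) auto
  also have "\<dots> \<le> card Y'" by (rule Y')
  finally have Y'c: "(p0 - \<delta>) ^ (Suc (card (T j)) + B j) * card (Y0 j) \<le> card Y'" .
  have mc: "mono_clique c j (insert u (T j))"
  proof -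
    have "c x u = j \<and> c u x = j" if "x \<in> T j" for x
      using T(3)[OF that] u sym[of u x] by (auto simp: nbhd_def)
    then show ?thesis using T(1) unfolding mono_clique_def by blast
  qed
  have card: "card (insert u (T j)) = Suc (card (T j))" using fT uT by simp
  have "colour_inv X' j (insert u (T j)) Y' (B j) (L j)"
    unfolding colour_inv_def card
  proof (intro conjI)
    show "\<forall>x\<in>insert u (T j). X' \<subseteq> nbhd c j x" using X' T(3) by blast
    show "\<forall>x\<in>insert u (T j). Y' \<subseteq> nbhd c j x" using Y' T(4) by blast
    show "\<forall>x\<in>X'. (p0 - \<delta> + z (Suc (card (T j))) (L j)) * card Y' \<le> card (nbhd c j x \<inter> Y')"
      using d by blast
  qed (use mc Tj fT Y' T(2) YY L Y'c u XX(1) in auto)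
  then have "colour_inv X' i ((T(j := insert u (T j))) i) ((Y(j := Y')) i) (B i) (L i)" if "i < r" for i
    using colour_inv_mono[OF XX(2)[OF that] X'(1)] by simp
  then show "inv X' (Y(j := Y')) (T(j := insert u (T j))) B L"
    unfolding inv_def sz using X' XX(1) X'c by blast
qed

text \<open>The page set moves into the neighbourhood of some vertex, but that vertex does not join
  the spine, since the new reservoir need not lie in its neighbourhood. The page set pays the factor
  p0 - \<delta> all the same, which is why boosts are counted in the exponent beside the
  spine.\<close>

lemma inv_boost_step:
  assumes inv: "inv X Y T B L" and j: "j < r" and s: "s0 \<le> s"
    and X': "X' \<subseteq> X" "X' \<noteq> {}" "exp (- G * ln (1 + 2 ^ s / real t)) * card X \<le> card X'"
    and Y': "Y' \<subseteq> Y j" "Y' \<noteq> {}" "(p0 - \<delta>) * card (Y j) \<le> card Y'"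
    and d: "\<And>v. v \<in> X' \<Longrightarrow>
      (p0 - \<delta> + z (card (T j)) (L j + ln (1 + 2 ^ s / real t))) * card Y' \<le> card (nbhd c j v \<inter> Y')"
  shows "inv X' (Y(j := Y')) T (B(j := Suc (B j))) (L(j := L j + ln (1 + 2 ^ s / real t)))"
proof -
  define g where "g = ln (1 + 2 ^ s / real t)"
  have XX: "X \<subseteq> X0" "\<And>i. i < r \<Longrightarrow> colour_inv X i (T i) (Y i) (B i) (L i)"
      "card X0 * exp (- a * (\<Sum>i<r. real (card (T i))) - G * (\<Sum>i<r. L i)) \<le> card X"
    using inv by (auto simp: inv_def)
  have T: "finite (T j)" "card (T j) \<le> t" "mono_clique c j (T j)" "T j \<subseteq> X0"
      "\<And>x. x \<in> T j \<Longrightarrow> X \<subseteq> nbhd c j x" "\<And>x. x \<in> T j \<Longrightarrow> Y j \<subseteq> nbhd c j x"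
    and YY: "Y j \<subseteq> Y0 j" "(p0 - \<delta>) ^ (card (T j) + B j) * card (Y0 j) \<le> card (Y j)"
    and L: "real (B j) * ln (1 + 2 ^ s0 / real t) \<le> L j"
    using XX(2)[OF j] unfolding colour_inv_def by auto
  have sz: "(\<Sum>i<r. (L(j := L j + g)) i) = (\<Sum>i<r. L i) + g"
    using j by (simp add: sum.remove[of "{..<r}" j])
  have "card X0 * exp (- a * (\<Sum>i<r. real (card (T i))) - G * ((\<Sum>i<r. L i) + g))
      = exp (- G * g) * (card X0 * exp (- a * (\<Sum>i<r. real (card (T i))) - G * (\<Sum>i<r. L i)))"
    by (simp add: algebra_simps flip: exp_add)
  also have "\<dots> \<le> exp (- G * g) * card X" using XX by (intro mult_left_mono) auto
  also have "\<dots> \<le> card X'" using X' by (simp add: g_def)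
  finally have X'c: "card X0 * exp (- a * (\<Sum>i<r. real (card (T i))) - G * ((\<Sum>i<r. L i) + g)) \<le> card X'" .
  have "(p0 - \<delta>) ^ (card (T j) + Suc (B j)) * card (Y0 j)
      = (p0 - \<delta>) * ((p0 - \<delta>) ^ (card (T j) + B j) * card (Y0 j))" by simp
  also have "\<dots> \<le> (p0 - \<delta>) * card (Y j)" using YY \<delta> by (intro mult_left_mono) auto
  also have "\<dots> \<le> card Y'" by (rule Y')
  finally have Y'c: "(p0 - \<delta>) ^ (card (T j) + Suc (B j)) * card (Y0 j) \<le> card Y'" .
  have "(2::real) ^ s0 \<le> 2 ^ s" using s by (intro power_increasing) auto
  then have "ln (1 + 2 ^ s0 / real t) \<le> g"
    unfolding g_def using t by (intro ln_mono) (auto simp: divide_right_mono add_pos_nonneg)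
  with L have "real (Suc (B j)) * ln (1 + 2 ^ s0 / real t) \<le> L j + g"
    by (simp add: algebra_simps)
  then have "colour_inv X' j (T j) Y' (Suc (B j)) (L j + g)"
    unfolding colour_inv_def g_def
    using T d X' Y' T YY Y'c XX(1) by (intro conjI) blast+
  then have "colour_inv X' i (T i) ((Y(j := Y')) i) ((B(j := Suc (B j))) i) ((L(j := L j + g)) i)"
    if "i < r" for i
    using colour_inv_mono[OF XX(2)[OF that] X'(1)] by simp
  then show ?thesis
    unfolding inv_def g_def[symmetric] sz using X' XX(1) X'c by blast
qed

text \<open>The factor 2 absorbs \<open>u\<close> itself, which has no colour towards itself; this
  is where two elements of X' are needed.\<close>

lemma majority_colour:
  assumes "finite X'" "2 \<le> card X'"
  obtains j where "j < r" "card X' \<le> 2 * r * card (X' \<inter> nbhd c j u)"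
proof (rule ccontr)
  assume no: "\<not> thesis"
  have "X' - {u} \<subseteq> (\<Union>j<r. X' \<inter> nbhd c j u)"
    using col by (auto simp: nbhd_def)
  then have "card (X' - {u}) \<le> card (\<Union>j<r. X' \<inter> nbhd c j u)"
    using assms by (intro card_mono) auto
  also have "\<dots> \<le> (\<Sum>j<r. card (X' \<inter> nbhd c j u))" by (rule card_UN_le) simp
  finally have "card X' - 1 \<le> (\<Sum>j<r. card (X' \<inter> nbhd c j u))"
    using card_Diff1_le[of X' u] card_Diff_singleton_if[of X' u] by (auto split: if_splits)
  then have "card X' \<le> 2 * (\<Sum>j<r. card (X' \<inter> nbhd c j u))" using assms by simp
  then have "r * card X' \<le> r * (2 * (\<Sum>j<r. card (X' \<inter> nbhd c j u)))" by (rule mult_le_mono2)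
  also have "\<dots> = (\<Sum>j<r. 2 * r * card (X' \<inter> nbhd c j u))"
    by (simp add: sum_distrib_left mult.left_commute mult.assoc)
  also have "\<dots> < (\<Sum>j<r. card X')"
  proof (intro sum_strict_mono)
    fix j assume "j \<in> {..<r}"
    then show "2 * r * card (X' \<inter> nbhd c j u) < card X'"
      using that[of j] no by (meson lessThan_iff not_le)
  qed (use r in auto)
  finally show False by simp
qed

lemma inv_step:
  assumes inv: "inv X Y T B L" and T: "\<And>i. i < r \<Longrightarrow> card (T i) < t"
  shows "\<exists>X' Y' T' B' L'. inv X' Y' T' B' L' \<and>
    (\<Sum>i<r. card (T' i) + B' i) = Suc (\<Sum>i<r. card (T i) + B i)"
proof -
  have X: "X \<subseteq> X0" "X \<noteq> {}" "finite X" using inv fin(1) by (auto simp: inv_def intro: finite_subset)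
  have ci: "colour_inv X i (T i) (Y i) (B i) (L i)" if "i < r" for i
    using inv that by (simp add: inv_def)
  have fY: "finite (Y i)" "Y i \<noteq> {}" if "i < r" for i
    using ci[OF that] fin(2)[OF that] unfolding colour_inv_def by (auto intro: finite_subset)
  have Yc: "0 < real (card (Y i))" if "i < r" for i using fY[OF that] by (simp add: card_gt_0_iff)
  \<comment> \<open>Trimming every neighbourhood to the minimum degree makes the sets
    \<open>Z i u\<close> equally large, as the kernel construction demands, without going below the
    density guaranteed by the invariant.\<close>
  define n where "n i = Min ((\<lambda>x. card (nbhd c i x \<inter> Y i)) ` X)" for i
  define p where "p i = real (n i) / card (Y i)" for i
  define \<alpha> where "\<alpha> i = (p i - (p0 - \<delta>)) / t" for i
  have z0: "0 < z m l" for m l using \<delta> t by (simp add: z_def)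
  have n_le: "n i \<le> card (nbhd c i x \<inter> Y i)" if "x \<in> X" for i x
    unfolding n_def using that X by (intro Min_le) auto
  have p_ge: "p0 - \<delta> + z (card (T i)) (L i) \<le> p i" if i: "i < r" for i
  proof -
    have "n i \<in> (\<lambda>x. card (nbhd c i x \<inter> Y i)) ` X"
      unfolding n_def using X by (intro Min_in) auto
    then obtain x where "x \<in> X" "n i = card (nbhd c i x \<inter> Y i)" by auto
    then have "(p0 - \<delta> + z (card (T i)) (L i)) * card (Y i) \<le> n i"
      using ci[OF i] by (simp add: colour_inv_def)
    then show ?thesis unfolding p_def using Yc[OF i] by (simp add: field_simps)
  qed
  have p_pos: "p0 - \<delta> < p i" "0 < p i" if "i < r" for i
    using p_ge[OF that] z0[of "card (T i)" "L i"] \<delta> by linarith+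
  have pY: "p i * card (Y i) = n i" if "i < r" for i using Yc[OF that] by (simp add: p_def)
  have n_pos: "0 < n i" if "i < r" for i
    using p_pos(2)[OF that] by (cases "n i") (auto simp: p_def)
  have \<alpha>: "0 < \<alpha> i" if "i < r" for i using p_pos[OF that] t by (simp add: \<alpha>_def)
  have "\<forall>i u. \<exists>S. u \<in> X \<longrightarrow> S \<subseteq> nbhd c i u \<inter> Y i \<and> card S = n i"
    using n_le by (metis obtain_subset_with_card_n)
  then obtain Z where Z: "\<And>i u. u \<in> X \<Longrightarrow> Z i u \<subseteq> nbhd c i u \<inter> Y i \<and> card (Z i u) = n i"
    by metis
  have Z_low: "(p0 - \<delta>) * card (Y i) \<le> card (Z i u)" "Z i u \<noteq> {}" if "i < r" "u \<in> X" for i u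
  proof -
    have "(p0 - \<delta>) * card (Y i) \<le> p i * card (Y i)"
      using p_pos[OF that(1)] by (intro mult_right_mono) auto
    then show "(p0 - \<delta>) * card (Y i) \<le> card (Z i u)" using pY[OF that(1)] Z[OF that(2), of i] by simp
    show "Z i u \<noteq> {}" using Z[OF that(2), of i] n_pos[OF that(1)] by auto
  qed
  have Z_deg: "q * card (Z i u) \<le> card (nbhd c i v \<inter> Z i u)"
    if "i < r" "u \<in> X" "v \<in> X" "q \<le> q'" "q' * n i \<le> card (Z i u \<inter> Z i v)"
    for i u v and q q' :: real
  proof -
    have fZ: "finite (Z i u)" using Z[OF that(2), of i] fY(1)[OF that(1)] by (meson finite_Int finite_subset)
    have "q * card (Z i u) \<le> q' * n i" using that Z[OF that(2), of i] by (simp add: mult_right_mono)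
    also have "\<dots> \<le> card (Z i u \<inter> Z i v)" by fact
    also have "\<dots> \<le> card (nbhd c i v \<inter> Z i u)"
      using Z[OF that(3), of i] fZ by (intro of_nat_mono card_mono) auto
    finally show ?thesis .
  qed
  have r4: "Z i u \<subseteq> Y i \<and> card (Z i u) = n i" if "i < r" "u \<in> X" for i u
    using Z[OF that(2), of i] by auto
  have Tle: "card (T i) \<le> t - 1" if "i < r" for i using T[OF that] by simp
  show ?thesis
  proof (rule common_neighbour_dichotomy[of X r k Y n \<alpha> Z s0, OF X(3,2) r k _ n_pos \<alpha> r4])
    fix u X'
    assume u: "u \<in> X" and X': "X' \<subseteq> X"
        "(1/2) ^ (3 * k * r * (s0 + 2)\<^sup>2) * real (card X) \<le> real (card X')"
      and d: "\<And>i v. i < r \<Longrightarrow> v \<in> X' \<Longrightarrow>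
        (real (n i) / card (Y i) - \<alpha> i) * n i \<le> card (Z i u \<inter> Z i v)"
    have fX': "finite X'" using X' X by (auto intro: finite_subset)
    \<comment> \<open>No spine is full, so at most r(t - 1) of the r t budgeted colour steps have
      been used. The budget for one more step is left, and after the balanced loss at least 2r
      vertices remain.\<close>
    have "2 \<le> real (card X')"
    proof -
      have "(\<Sum>i<r. real (card (T i))) \<le> (\<Sum>i<r. real (t - 1))"
        using Tle by (intro sum_mono of_nat_mono) auto
      also have "\<dots> = real r * (real t - 1)" using t by (simp add: of_nat_diff)
      also have "\<dots> \<le> real r * real t - 1" using r by (simp add: algebra_simps)
      finally have sT: "(\<Sum>i<r. real (card (T i))) \<le> real r * real t - 1" .
      have a0: "0 \<le> a" unfolding a_def using r by (intro add_nonneg_nonneg mult_nonneg_nonneg ln_ge_zero) auto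
      have "(\<Sum>i<r. L i) \<le> (\<Sum>i<r. ln (9 / \<delta>))" using L_bounds[OF inv] by (intro sum_mono) auto
      then have sL: "(\<Sum>i<r. L i) \<le> real r * ln (9 / \<delta>)" by simp
      have "a * (\<Sum>i<r. real (card (T i))) \<le> a * (real r * real t - 1)"
        using sT a0 by (rule mult_left_mono)
      moreover have "G * (\<Sum>i<r. L i) \<le> G * (real r * ln (9 / \<delta>))"
        using sL G by (rule mult_left_mono)
      ultimately have e: "a - (a * (real r * real t) + G * (real r * ln (9 / \<delta>)))
          \<le> - a * (\<Sum>i<r. real (card (T i))) - G * (\<Sum>i<r. L i)"
        by (simp add: algebra_simps)
      have "exp a = exp (a * (real r * real t) + G * (real r * ln (9 / \<delta>)))
          * exp (a - (a * (real r * real t) + G * (real r * ln (9 / \<delta>))))"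
        by (simp flip: exp_add)
      also have "\<dots> \<le> card X0 * exp (- a * (\<Sum>i<r. real (card (T i))) - G * (\<Sum>i<r. L i))"
        using size e unfolding a_def[symmetric] by (intro mult_mono) auto
      also have "\<dots> \<le> card X" using inv by (simp add: inv_def)
      finally have "exp a \<le> card X" .
      then have "2 * real r * exp (- a) * exp a \<le> 2 * real r * exp (- a) * card X"
        by (intro mult_left_mono) auto
      also have "\<dots> \<le> card X'" using X'(2) unfolding color_step_loss .
      finally have "2 * real r * (exp (- a) * exp a) \<le> card X'" by (simp only: mult.assoc)
      then have "2 * real r \<le> card X'" by (simp flip: exp_add)
      moreover have "1 \<le> real r" using r by simp
      ultimately show ?thesis by linarith
    qed
    then have "2 \<le> card X'" by simp
    then obtain j where j: "j < r" "card X' \<le> 2 * r * card (X' \<inter> nbhd c j u)"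
      using majority_colour[OF fX'] by blast
    define X'' where "X'' = X' \<inter> nbhd c j u"
    have cX'': "exp (- a) * card X \<le> card X''"
    proof -
      have "real (card X') \<le> real (2 * r * card X'')" using j(2) unfolding X''_def of_nat_le_iff .
      then have "2 * real r * exp (- a) * card X \<le> 2 * real r * card X''"
        using X'(2) unfolding color_step_loss by simp
      then show ?thesis using r by simp
    qed
    have ne: "X'' \<noteq> {}" using j(2) \<open>2 \<le> card X'\<close> unfolding X''_def by (metis card.empty mult_0_right not_numeral_le_zero order_trans)
    have step: "inv X'' (Y(j := Z j u)) (T(j := insert u (T j))) B L" "u \<notin> T j"
    proof -
      have Zu: "Z j u \<subseteq> Y j" "Z j u \<subseteq> nbhd c j u" using Z[OF u, of j] by auto
      have dd: "(p0 - \<delta> + z (Suc (card (T j))) (L j)) * card (Z j u) \<le> card (nbhd c j v \<inter> Z j u)"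
        if v: "v \<in> X''" for v
      proof (rule Z_deg[OF j(1) u])
        show "v \<in> X" using v X' by (auto simp: X''_def)
        show "(p j - \<alpha> j) * n j \<le> card (Z j u \<inter> Z j v)"
          using d[OF j(1)] v unfolding p_def X''_def by auto
        have "z (Suc (card (T j))) (L j) = z (card (T j)) (L j) * (1 - 1 / t)"
          by (simp add: z_def)
        also have "\<dots> \<le> (p j - (p0 - \<delta>)) * (1 - 1 / t)"
          using p_ge[OF j(1)] t by (intro mult_right_mono) auto
        finally show "p0 - \<delta> + z (Suc (card (T j))) (L j) \<le> p j - \<alpha> j"
          by (simp add: \<alpha>_def algebra_simps diff_divide_distrib)
      qed
      show "inv X'' (Y(j := Z j u)) (T(j := insert u (T j))) B L" "u \<notin> T j"
        using inv_colour_step[OF inv j(1) u T[OF j(1)] _ _ ne cX'' Zu Z_low(2,1)[OF j(1) u] dd] X'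
        unfolding X''_def by auto
    qed
    have "finite (T j)" using ci[OF j(1)] by (simp add: colour_inv_def)
    then have "(\<Sum>i<r. card ((T(j := insert u (T j))) i) + B i) = Suc (\<Sum>i<r. card (T i) + B i)"
      using j(1) step(2) by (simp add: sum.remove[of "{..<r}" j])
    with step(1) show ?thesis by blast
  next
    fix u j s X'
    assume u: "u \<in> X" and j: "j < r" and s: "s0 \<le> s" and X': "X' \<subseteq> X"
        "(1/2) ^ (3 * k * r * (s + 3)\<^sup>2) * real (card X) \<le> real (card X')"
      and d: "\<And>v. v \<in> X' \<Longrightarrow>
        (real (n j) / card (Y j) + 2 ^ s * \<alpha> j) * n j \<le> card (Z j u \<inter> Z j v)"
    have "0 < (1/2) ^ (3 * k * r * (s + 3)\<^sup>2) * real (card X)"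
      using X by (simp add: card_gt_0_iff)
    then have "0 < real (card X')" using X'(2) by linarith
    then have ne: "X' \<noteq> {}" by auto
    then obtain v where v: "v \<in> X'" by auto
    have fZ: "finite (Z j u)" using Z[OF u, of j] fY(1)[OF j] by (meson finite_Int finite_subset)
    \<comment> \<open>A codegree is at most \<open>n j\<close>. Together with the lower bound
      \<delta>/(9t) for \<open>\<alpha> j\<close> this confines \<open>s\<close> to the range in
      which \<open>cost\<close> applies.\<close>
    have "(p j + 2 ^ s * \<alpha> j) * n j \<le> card (Z j u \<inter> Z j v)" using d[OF v] by (simp add: p_def)
    also have "\<dots> \<le> card (Z j u)" using fZ by (intro of_nat_mono card_mono) auto
    also have "\<dots> = 1 * real (n j)" using Z[OF u, of j] by simp
    finally have "p j + 2 ^ s * \<alpha> j \<le> 1" using n_pos[OF j] by (simp add: mult_le_cancel_right)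
    then have le1: "2 ^ s * \<alpha> j \<le> 1" using p_pos(2)[OF j] by linarith
    have "\<delta> / 9 * 1 \<le> \<delta> / 9 * exp (L j)" using L_bounds(1)[OF inv j] \<delta> by (intro mult_left_mono) auto
    also have "\<dots> \<le> z (card (T j)) (L j)" using T[OF j] by (intro z_ge) simp
    also have "\<dots> \<le> p j - (p0 - \<delta>)" using p_ge[OF j] by simp
    finally have "\<delta> / 9 / t \<le> \<alpha> j" unfolding \<alpha>_def by (intro divide_right_mono) auto
    then have "2 ^ s * (\<delta> / 9 / t) \<le> 2 ^ s * \<alpha> j" by (intro mult_left_mono) auto
    with le1 have "2 ^ s * (\<delta> / 9 / t) \<le> 1" by linarith
    then have "2 ^ s \<le> 9 * real t / \<delta>" using \<delta> t by (simp add: field_simps)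
    from cost[OF s this] have "- G * ln (1 + 2 ^ s / real t) \<le> - (real (3 * k * r * (s + 3)\<^sup>2) * ln 2)"
      by simp
    then have "exp (- G * ln (1 + 2 ^ s / real t)) * card X \<le> (1/2) ^ (3 * k * r * (s + 3)\<^sup>2) * card X"
      unfolding half_power_eq_exp by (intro mult_right_mono) auto
    also have "\<dots> \<le> card X'" by (rule X')
    finally have cX': "exp (- G * ln (1 + 2 ^ s / real t)) * card X \<le> card X'" .
    have dd: "(p0 - \<delta> + z (card (T j)) (L j + ln (1 + 2 ^ s / real t))) * card (Z j u)
        \<le> card (nbhd c j v \<inter> Z j u)" if v: "v \<in> X'" for v
    proof (rule Z_deg[OF j u])
      show "v \<in> X" using v X' by auto
      show "(p j + 2 ^ s * \<alpha> j) * n j \<le> card (Z j u \<inter> Z j v)" using d[OF v] by (simp add: p_def)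
      have "0 < 1 + 2 ^ s / real t" by (intro add_pos_nonneg) auto
      then have "z (card (T j)) (L j + ln (1 + 2 ^ s / real t)) = z (card (T j)) (L j) * (1 + 2 ^ s / t)"
        by (simp add: z_def exp_add)
      also have "\<dots> \<le> (p j - (p0 - \<delta>)) * (1 + 2 ^ s / t)"
        using p_ge[OF j] by (intro mult_right_mono) auto
      finally show "p0 - \<delta> + z (card (T j)) (L j + ln (1 + 2 ^ s / real t)) \<le> p j + 2 ^ s * \<alpha> j"
        by (simp add: \<alpha>_def algebra_simps diff_divide_distrib add_divide_distrib)
    qed
    have "Z j u \<subseteq> Y j" using Z[OF u, of j] by auto
    then have "inv X' (Y(j := Z j u)) T (B(j := Suc (B j))) (L(j := L j + ln (1 + 2 ^ s / real t)))"
      by (rule inv_boost_step[OF inv j s X'(1) ne cX' _ Z_low(2,1)[OF j u] dd])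
    moreover have "(\<Sum>i<r. card (T i) + (B(j := Suc (B j))) i) = Suc (\<Sum>i<r. card (T i) + B i)"
      using j by (simp add: sum.remove[of "{..<r}" j])
    ultimately show ?thesis by blast
  qed (use fY in auto)
qed

lemma inv_initial: "inv X0 Y0 (\<lambda>_. {}) (\<lambda>_. 0) (\<lambda>_. 0)"
proof -
  have "X0 \<noteq> {}"
  proof
    assume "X0 = {}"
    then show False using size by (simp add: not_le[symmetric])
  qed
  moreover have "colour_inv X0 i {} (Y0 i) 0 0" if "i < r" for i
    using Y0[OF that] deg[OF that] by (simp add: colour_inv_def mono_clique_def z_def)
  ultimately show ?thesis by (simp add: inv_def)
qed

text \<open>As long as no spine has \<open>t\<close> vertices, a further move is possible and raises
  the total number of spine vertices and boosts by one. That number is bounded, since every boost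
  adds at least \<open>ln (1 + 2 ^ s0 / real t)\<close> to a quantity that cannot exceed
  \<open>ln (9 / \<delta>)\<close>.\<close>

theorem book_exists:
  obtains j T Y b where "j < r" "T \<subseteq> X0" "card T = t" "mono_clique c j T" "Y \<subseteq> Y0 j"
    "\<And>x. x \<in> T \<Longrightarrow> Y \<subseteq> nbhd c j x"
    "real b * ln (1 + 2 ^ s0 / real t) \<le> ln (9 / \<delta>)" "(p0 - \<delta>) ^ (t + b) * card (Y0 j) \<le> card Y"
proof (rule ccontr)
  assume no: "\<not> thesis"
  note book = that
  define w where "w = ln (1 + 2 ^ s0 / real t)"
  have w: "0 < w" using boost_unit_pos by (simp add: w_def)
  have B_le: "real (B i) * w \<le> ln (9 / \<delta>)" if "inv X Y T B L" "i < r" for X Y T B L i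
  proof -
    have "real (B i) * w \<le> L i" using that by (simp add: inv_def colour_inv_def w_def)
    then show ?thesis using L_bounds(2)[OF that] by linarith
  qed
  have T_lt: "card (T i) < t" if "inv X Y T B L" "i < r" for X Y T B L i
  proof (rule ccontr)
    assume "\<not> card (T i) < t"
    moreover have ci: "colour_inv X i (T i) (Y i) (B i) (L i)" using that by (simp add: inv_def)
    ultimately have "card (T i) = t" unfolding colour_inv_def by linarith
    with ci B_le[OF that] book[of i "T i" "Y i" "B i"] \<open>i < r\<close> no show False
      unfolding colour_inv_def w_def by auto
  qed
  have grow: "\<exists>X Y T B L. inv X Y T B L \<and> (\<Sum>i<r. card (T i) + B i) = n" for n
  proof (induction n)
    case 0
    show ?case using inv_initial by fastforce
  next
    case (Suc n)
    then obtain X Y T B L where I: "inv X Y T B L" and sum: "(\<Sum>i<r. card (T i) + B i) = n" by blast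
    show ?case using inv_step[OF I T_lt[OF I]] unfolding sum by blast
  qed
  define N where "N = r * (t + nat \<lceil>ln (9 / \<delta>) / w\<rceil>)"
  obtain X Y T B L where I: "inv X Y T B L" and sum: "(\<Sum>i<r. card (T i) + B i) = Suc N"
    using grow[of "Suc N"] by blast
  have "(\<Sum>i<r. card (T i) + B i) \<le> (\<Sum>i<r. t + nat \<lceil>ln (9 / \<delta>) / w\<rceil>)"
  proof (intro sum_mono add_mono)
    fix i assume "i \<in> {..<r}"
    then have i: "i < r" by simp
    show "card (T i) \<le> t" using T_lt[OF I i] by simp
    have "real (B i) \<le> ln (9 / \<delta>) / w" using B_le[OF I i] w by (simp add: field_simps)
    also have "\<dots> \<le> real (nat \<lceil>ln (9 / \<delta>) / w\<rceil>)" by (rule real_nat_ceiling_ge)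
    finally show "B i \<le> nat \<lceil>ln (9 / \<delta>) / w\<rceil>" by simp
  qed
  also have "\<dots> = N" by (simp add: N_def)
  finally show False using sum by simp
qed

end

section \<open>The weighted Erdos-Szekeres bound and books\<close>

definition has_clique :: "('a \<Rightarrow> 'a \<Rightarrow> nat) \<Rightarrow> nat \<Rightarrow> 'a set \<Rightarrow> (nat \<Rightarrow> nat) \<Rightarrow> bool" where
  "has_clique c r W k \<longleftrightarrow> (\<exists>i<r. \<exists>S\<subseteq>W. finite S \<and> card S = k i \<and> mono_clique c i S)"

lemma has_clique_extend:
  assumes sym: "\<And>x y. c x y = c y x" and j: "j < r"
    and T: "T \<subseteq> W" "finite T" "card T \<le> k j" "mono_clique c j T"
    and Y: "Y \<subseteq> W" "\<And>x. x \<in> T \<Longrightarrow> Y \<subseteq> nbhd c j x"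
    and H: "has_clique c r Y (k(j := k j - card T))"
  shows "has_clique c r W k"
proof -
  obtain i S where i: "i < r" and S: "S \<subseteq> Y" "finite S" "card S = (k(j := k j - card T)) i"
      "mono_clique c i S"
    using H by (auto simp: has_clique_def)
  show ?thesis
  proof (cases "i = j")
    case True
    have e: "x \<noteq> y \<and> c x y = j \<and> c y x = j" if "x \<in> T" "y \<in> S" for x y
      using Y(2)[OF that(1)] that(2) S(1) sym[of x y] by (auto simp: nbhd_def)
    then have "T \<inter> S = {}" by blast
    then have "card (T \<union> S) = k j" using T S True by (simp add: card_Un_disjoint)
    moreover have "mono_clique c j (T \<union> S)"
      using e T(4) S(4) True unfolding mono_clique_def by blast
    ultimately show ?thesis
      unfolding has_clique_def using j T S Y(1)
      by (intro exI[of _ j] conjI exI[of _ "T \<union> S"]) auto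
  next
    case False
    then show ?thesis using i S Y(1) unfolding has_clique_def by auto
  qed
qed

text \<open>The factor 2 absorbs the vertex that is lost in each step of the induction.\<close>

lemma erdos_szekeres_weighted:
  fixes q :: "nat \<Rightarrow> real"
  assumes sym: "\<And>x y. c x y = c y x" and col: "\<And>x y. c x y < r" and r: "2 \<le> r"
    and q: "\<And>i. i < r \<Longrightarrow> 0 < q i" "(\<Sum>i<r. q i) \<le> 1"
    and W: "finite W" "2 * (\<Prod>i<r. (1 / q i) ^ k i) \<le> card W + 1"
  shows "has_clique c r W k"
  using W
proof (induction "\<Sum>i<r. k i" arbitrary: k W)
  case 0
  then have "k 0 = 0" using r by simp
  then show ?case
    unfolding has_clique_def using r
    by (intro exI[of _ 0] conjI exI[of _ "{}"]) (auto simp: mono_clique_def)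
next
  case (Suc n)
  show ?case
  proof (cases "\<exists>i<r. k i = 0")
    case True
    then obtain i where "i < r" "k i = 0" by auto
    then show ?thesis
      unfolding has_clique_def
      by (intro exI[of _ i] conjI exI[of _ "{}"]) (auto simp: mono_clique_def)
  next
    case False
    define P where "P = (\<Prod>i<r. (1 / q i) ^ k i)"
    have P0: "0 < P" unfolding P_def using q(1) by (intro prod_pos) auto
    have P1: "1 \<le> P"
    proof -
      have "q i \<le> 1" if "i < r" for i
      proof -
        have "q i \<le> (\<Sum>i<r. q i)" using that q(1) by (intro member_le_sum) (auto simp: less_imp_le)
        then show ?thesis using q(2) by linarith
      qed
      then show ?thesis
        unfolding P_def using q(1) by (intro prod_ge_1 one_le_power) (auto simp: field_simps)
    qed
    then have "W \<noteq> {}" using Suc.prems unfolding P_def[symmetric] by auto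
    then obtain v where v: "v \<in> W" by auto
    have Pj: "(\<Prod>i<r. (1 / q i) ^ ((k(j := k j - 1)) i)) = q j * P" if j: "j < r" for j
    proof -
      have "k j \<noteq> 0" using False j by auto
      then have "(1 / q j) ^ (k j - 1) = q j * (1 / q j) ^ k j"
        using q(1)[OF j] by (cases "k j") auto
      moreover have "(\<Prod>i\<in>{..<r} - {j}. (1 / q i) ^ ((k(j := k j - 1)) i))
          = (\<Prod>i\<in>{..<r} - {j}. (1 / q i) ^ k i)"
        by (intro prod.cong) auto
      ultimately show ?thesis
        unfolding P_def using j by (simp add: prod.remove[of "{..<r}" j])
    qed
    \<comment> \<open>Were all neighbourhoods too small, the \<open>r\<close> summands +1 would give
      card W + r < 2P + 1 \<le> card W + 2, which is impossible for r \<ge> 2.\<close>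
    have "\<exists>j<r. 2 * (q j * P) \<le> card (W \<inter> nbhd c j v) + 1"
    proof (rule ccontr)
      assume "\<not> ?thesis"
      then have lt: "real (card (W \<inter> nbhd c j v)) + 1 < 2 * (q j * P)" if "j < r" for j
        using that by force
      have "W - {v} \<subseteq> (\<Union>j<r. W \<inter> nbhd c j v)" using col by (auto simp: nbhd_def)
      then have "card (W - {v}) \<le> card (\<Union>j<r. W \<inter> nbhd c j v)"
        using Suc.prems by (intro card_mono) auto
      also have "\<dots> \<le> (\<Sum>j<r. card (W \<inter> nbhd c j v))" by (rule card_UN_le) simp
      finally have "card W \<le> (\<Sum>j<r. card (W \<inter> nbhd c j v)) + 1" using v Suc.prems by simp
      then have "real (card W) \<le> real ((\<Sum>j<r. card (W \<inter> nbhd c j v)) + 1)" by (rule of_nat_mono)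
      then have "real (card W) + r \<le> (\<Sum>j<r. real (card (W \<inter> nbhd c j v)) + 1) + 1"
        by (simp add: sum.distrib)
      moreover have "(\<Sum>j<r. real (card (W \<inter> nbhd c j v)) + 1) < (\<Sum>j<r. 2 * (q j * P))"
        using lt r by (intro sum_strict_mono) (auto simp: lessThan_empty_iff)
      moreover have "(\<Sum>j<r. 2 * (q j * P)) = 2 * P * (\<Sum>j<r. q j)"
        by (simp add: sum_distrib_left ac_simps)
      moreover have "2 * P * (\<Sum>j<r. q j) \<le> 2 * P * 1"
        using q(2) P0 by (intro mult_left_mono) auto
      ultimately show False using Suc.prems(2) r unfolding P_def[symmetric] by linarith
    qed
    then obtain j where j: "j < r" "2 * (q j * P) \<le> card (W \<inter> nbhd c j v) + 1" by blast
    have kj: "1 \<le> k j" using False j(1) by (metis One_nat_def Suc_leI neq0_conv)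
    show ?thesis
    proof (rule has_clique_extend[where T = "{v}" and Y = "W \<inter> nbhd c j v", OF sym j(1)])
      show "has_clique c r (W \<inter> nbhd c j v) (k(j := k j - card {v}))"
      proof (rule Suc.hyps(1))
        have "(\<Sum>i<r. k i) = k j + (\<Sum>i\<in>{..<r} - {j}. k i)"
          using j(1) by (simp add: sum.remove[of "{..<r}" j])
        moreover have "(\<Sum>i<r. (k(j := k j - 1)) i) = (k j - 1) + (\<Sum>i\<in>{..<r} - {j}. k i)"
          using j(1) by (simp add: sum.remove[of "{..<r}" j])
        ultimately show "n = (\<Sum>i<r. (k(j := k j - card {v})) i)"
          using Suc.hyps(2) kj by simp
        show "2 * (\<Prod>i<r. (1 / q i) ^ ((k(j := k j - card {v})) i))
            \<le> card (W \<inter> nbhd c j v) + 1"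
          using j(2) Pj[OF j(1)] by simp
      qed (use Suc.prems in simp)
    qed (use v kj in \<open>auto simp: mono_clique_def\<close>)
  qed
qed

text \<open>As long as some vertex has a colour degree exceeding the average by the factor \<open>1 + \<epsilon>\<close>, passing to its
  neighbourhood gains that factor over the Erdos-Szekeres bound. Otherwise all colour degrees are
  nearly equal, and a large monochromatic book is available.\<close>

lemma has_clique_of_parameters:
  fixes c :: "'a \<Rightarrow> 'a \<Rightarrow> nat" and r k S t kk s0 :: nat and \<epsilon> \<delta> G \<theta> w :: real
  defines "p0 \<equiv> (1 - \<epsilon> * real r) / real r"
  assumes sym: "\<And>x y. c x y = c y x" and col: "\<And>x y. c x y < r" and r: "2 \<le> r"
    and V: "finite V" and \<epsilon>: "0 < \<epsilon>" and \<theta>: "0 < \<theta>" "\<theta> < 1"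
    and many: "2 * real r ^ (r * k) \<le> (1 + \<epsilon>) ^ S * card V"
    and St: "S + t \<le> k" and t: "2 \<le> t" and kk: "4 * real r \<le> 9 ^ kk"
    and \<delta>: "0 < \<delta>" "\<delta> < p0" and G: "0 \<le> G"
    and cost: "\<And>s. s0 \<le> s \<Longrightarrow> 2 ^ s \<le> 9 * real t / \<delta> \<Longrightarrow>
      real (3 * kk * r * (s + 3)\<^sup>2) * ln 2 \<le> G * ln (1 + 2 ^ s / real t)"
    and w: "w * real r ^ S \<le> card V" "real r / \<epsilon> \<le> w"
      "exp ((ln (2 * real r) + real (3 * kk * r * (s0 + 2)\<^sup>2) * ln 2) * (real r * real t)
        + G * (real r * ln (9 / \<delta>))) \<le> w"
    and gain: "\<And>b. real b * ln (1 + 2 ^ s0 / real t) \<le> ln (9 / \<delta>) \<Longrightarrow>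
      2 * real r ^ (r * k) * (1 / (1 - \<theta>)) ^ (k - t)
        \<le> (p0 - \<delta>) ^ (t + b) * real r ^ t * (1 + \<theta> / (real r - 1)) ^ ((r - 1) * k - S) * card V"
  shows "has_clique c r V (\<lambda>_. k)"
proof -
  have r0: "0 < real r" using r by simp
  \<comment> \<open>\<open>u\<close> counts the vertices already taken by degree increments. The
    targets have dropped by \<open>u\<close> in total, while \<open>W\<close> is larger by (1 +
    \<epsilon>)^u than the uniform bound predicts. The induction is on the number of increments
    still to come.\<close>
  have main: "has_clique c r W k'"
    if "u \<le> S" "W \<subseteq> V" "((1 + \<epsilon>) / r) ^ u * card V \<le> card W"
      "\<And>i. i < r \<Longrightarrow> k' i \<le> k" "(\<Sum>i<r. k' i) + u = r * k" for u W k'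
    using that
  proof (induction "S - u" arbitrary: u W k')
    case 0
    then have u: "u = S" by simp
    show ?case
    proof (rule erdos_szekeres_weighted[where q = "\<lambda>_. 1 / real r", OF sym col r])
      show "finite W" using 0 V by (auto intro: finite_subset)
      have "(\<Prod>i<r. (1 / (1 / real r)) ^ k' i) * real r ^ S = real r ^ (r * k)"
        using 0 u by (simp flip: power_sum power_add)
      then have "2 * (\<Prod>i<r. (1 / (1 / real r)) ^ k' i) * real r ^ S \<le> (1 + \<epsilon>) ^ S * card V"
        using many by simp
      also have "\<dots> = ((1 + \<epsilon>) / r) ^ S * card V * real r ^ S" using r0 by (simp add: power_divide)
      also have "\<dots> \<le> real (card W) * real r ^ S" using 0 u by (intro mult_right_mono) auto
      finally show "2 * (\<Prod>i<r. (1 / (1 / real r)) ^ k' i) \<le> card W + 1"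
        using r0 by (simp add: mult_le_cancel_right)
    qed (use r0 in auto)
  next
    case (Suc n)
    have fW: "finite W" using Suc.prems V by (auto intro: finite_subset)
    have uS: "u < S" using Suc.hyps by simp
    show ?case
    proof (cases "\<exists>x\<in>W. \<exists>j<r. (1 + \<epsilon>) / r * card W \<le> card (W \<inter> nbhd c j x)")
      case True
      then obtain x j where x: "x \<in> W" and j: "j < r"
        and big: "(1 + \<epsilon>) / r * card W \<le> card (W \<inter> nbhd c j x)" by auto
      have sj: "(\<Sum>i<r. k' i) = k' j + (\<Sum>i\<in>{..<r} - {j}. k' i)"
        using j by (simp add: sum.remove[of "{..<r}" j])
      \<comment> \<open>With one target used up, the others would sum to at most (r - 1)k, so
        \<open>u\<close> would be at least \<open>k\<close>, although fewer than S \<le> k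
        increments have occurred.\<close>
      have kj: "1 \<le> k' j"
      proof (rule ccontr)
        assume "\<not> 1 \<le> k' j"
        then have "(\<Sum>i<r. k' i) = (\<Sum>i\<in>{..<r} - {j}. k' i)" using sj by simp
        also have "\<dots> \<le> (\<Sum>i\<in>{..<r} - {j}. k)" using Suc.prems(4) by (intro sum_mono) auto
        also have "\<dots> = (r - 1) * k" using j by simp
        finally have "r * k \<le> (r - 1) * k + u" using Suc.prems(5) by simp
        moreover have "r * k = (r - 1) * k + k" using r by (cases r) auto
        ultimately show False using St uS t by linarith
      qed
      show ?thesis
      proof (rule has_clique_extend[where T = "{x}" and Y = "W \<inter> nbhd c j x", OF sym j])
        show "has_clique c r (W \<inter> nbhd c j x) (k'(j := k' j - card {x}))"
        proof (rule Suc.hyps(1)[of "Suc u"])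
          show "n = S - Suc u" using Suc.hyps by simp
          show "Suc u \<le> S" using uS by simp
          have "((1 + \<epsilon>) / r) ^ Suc u * card V = (1 + \<epsilon>) / r * (((1 + \<epsilon>) / r) ^ u * card V)" by simp
          also have "\<dots> \<le> (1 + \<epsilon>) / r * card W"
            using Suc.prems(3) \<epsilon> by (intro mult_left_mono) auto
          finally show "((1 + \<epsilon>) / r) ^ Suc u * card V \<le> card (W \<inter> nbhd c j x)" using big by linarith
          have "(\<Sum>i<r. (k'(j := k' j - 1)) i) = (k' j - 1) + (\<Sum>i\<in>{..<r} - {j}. k' i)"
            using j by (simp add: sum.remove[of "{..<r}" j])
          then show "(\<Sum>i<r. (k'(j := k' j - card {x})) i) + Suc u = r * k"
            using Suc.prems(5) sj kj by simp
        qed (use Suc.prems in \<open>auto intro: le_trans[OF diff_le_self]\<close>)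
      qed (use x kj in \<open>auto simp: mono_clique_def\<close>)
    next
      case False
      then have small: "card (W \<inter> nbhd c j x) \<le> (1 + \<epsilon>) / r * card W" if "x \<in> W" "j < r" for x j
        using that by (meson less_imp_le not_le)
      have "w * real r ^ u \<le> w * real r ^ S"
        using uS r0 r w(2) \<epsilon> by (intro mult_left_mono power_increasing) (auto intro: order_trans[rotated])
      also have "\<dots> \<le> card V" by (rule w)
      also have "\<dots> \<le> (1 + \<epsilon>) ^ u * card V"
        using \<epsilon> by (simp add: mult_le_cancel_right1 one_le_power)
      finally have "w * real r ^ u \<le> (1 + \<epsilon>) ^ u * card V" .
      then have "w \<le> ((1 + \<epsilon>) / r) ^ u * card V" using r0 by (simp add: power_divide field_simps)
      also have "\<dots> \<le> card W" by (rule Suc.prems)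
      finally have wW: "w \<le> card W" .
      \<comment> \<open>What the other r - 1 colours leave over is a share of p0 + \<epsilon>/r, up
        to the vertex \<open>x\<close> itself. The term \<epsilon>/r absorbs \<open>x\<close>,
        because \<open>W\<close> has at least r/\<epsilon> elements.\<close>
      have deg: "p0 * card W \<le> card (nbhd c i x \<inter> W)" if x: "x \<in> W" and i: "i < r" for i x
      proof -
        have "W - {x} \<subseteq> (\<Union>j<r. W \<inter> nbhd c j x)" using col by (auto simp: nbhd_def)
        then have "card (W - {x}) \<le> card (\<Union>j<r. W \<inter> nbhd c j x)"
          using fW by (intro card_mono) auto
        also have "\<dots> \<le> (\<Sum>j<r. card (W \<inter> nbhd c j x))" by (rule card_UN_le) simp
        finally have "card W \<le> (\<Sum>j<r. card (W \<inter> nbhd c j x)) + 1" using x fW by simp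
        then have "real (card W) \<le> real ((\<Sum>j<r. card (W \<inter> nbhd c j x)) + 1)" by (rule of_nat_mono)
        also have "\<dots> = card (W \<inter> nbhd c i x) + (\<Sum>j\<in>{..<r} - {i}. real (card (W \<inter> nbhd c j x))) + 1"
          using i by (simp add: sum.remove[of "{..<r}" i])
        also have "(\<Sum>j\<in>{..<r} - {i}. real (card (W \<inter> nbhd c j x)))
            \<le> (\<Sum>j\<in>{..<r} - {i}. (1 + \<epsilon>) / r * card W)"
          using small[OF x] by (intro sum_mono) auto
        also have "\<dots> = (real r - 1) * ((1 + \<epsilon>) / r * card W)" using i r by (simp add: of_nat_diff)
        finally have A: "card W \<le> card (W \<inter> nbhd c i x) + (real r - 1) * ((1 + \<epsilon>) / r * card W) + 1"
          by simp
        have "real r / \<epsilon> \<le> card W" using w(2) wW by linarith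
        then have "1 \<le> \<epsilon> / r * card W" using \<epsilon> r0 by (simp add: field_simps)
        moreover have "p0 * card W = card W - (real r - 1) * ((1 + \<epsilon>) / r * card W) - \<epsilon> / r * card W"
          unfolding p0_def using r0 by (simp add: field_simps)
        ultimately have "p0 * card W \<le> card (W \<inter> nbhd c i x)" using A by linarith
        then show ?thesis by (simp add: Int_commute)
      qed
      have "0 < card W"
      proof -
        have "0 < real r / \<epsilon>" using r0 \<epsilon> by simp
        then have "0 < real (card W)" using w(2) wW by linarith
        then show ?thesis by simp
      qed
      then have "W \<noteq> {}" by auto
      \<comment> \<open>The reservoir and all page sets start out as the same set
        \<open>W\<close>.\<close>
      interpret book: book_setup c r t s0 kk p0 \<delta> G W "\<lambda>_. W"
        by unfold_locales
          (use sym col r t kk \<delta> G fW \<open>W \<noteq> {}\<close> deg cost wW w(3) in auto)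
      obtain j T Y b where j: "j < r" and T: "T \<subseteq> W" "card T = t" "mono_clique c j T"
        and Y: "Y \<subseteq> W" "\<And>x. x \<in> T \<Longrightarrow> Y \<subseteq> nbhd c j x"
        and b: "real b * ln (1 + 2 ^ s0 / real t) \<le> ln (9 / \<delta>)"
        and Yc: "(p0 - \<delta>) ^ (t + b) * card W \<le> card Y"
        using book.book_exists by metis
      have sj: "(\<Sum>i<r. k' i) = k' j + (\<Sum>i\<in>{..<r} - {j}. k' i)"
        using j by (simp add: sum.remove[of "{..<r}" j])
      define A where "A = (\<Sum>i\<in>{..<r} - {j}. k' i)"
      have "A \<le> (\<Sum>i\<in>{..<r} - {j}. k)" unfolding A_def using Suc.prems(4) by (intro sum_mono) auto
      then have A1: "A \<le> (r - 1) * k" using j by simp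
      have rk: "r * k = (r - 1) * k + k" using r by (cases r) auto
      have kjA: "k' j + A + u = r * k" using Suc.prems(5) sj by (simp add: A_def)
      have tk: "t \<le> k' j" using kjA A1 rk St uS by linarith
      have A2: "(r - 1) * k - S \<le> A" using kjA Suc.prems(4)[OF j] rk uS by linarith
      show ?thesis
      proof (rule has_clique_extend[where T = T and Y = Y, OF sym j])
        \<comment> \<open>The tilt: a smaller weight is cheap in colour \<open>j\<close>, whose
          target has just lost \<open>t\<close>, and the larger weights help in the other colours,
          whose targets still sum to at least (r - 1)k - S by \<open>A2\<close>.\<close>
        define q where "q i = (if i = j then 1 - \<theta> else 1 + \<theta> / (real r - 1)) / r" for i
        show "has_clique c r Y (k'(j := k' j - card T))"
        proof (rule erdos_szekeres_weighted[where q = q, OF sym col r])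
          have r1: "0 < real r - 1" "real (r - 1) = real r - 1" using r by (auto simp: of_nat_diff)
          show "0 < q i" for i using \<theta> r1 r0 by (auto simp: q_def intro!: divide_pos_pos add_pos_nonneg)
          have "(\<Sum>i<r. q i) = q j + (\<Sum>i\<in>{..<r} - {j}. q i)"
            using j by (simp add: sum.remove[of "{..<r}" j])
          also have "(\<Sum>i\<in>{..<r} - {j}. q i) = (\<Sum>i\<in>{..<r} - {j}. (1 + \<theta> / (real r - 1)) / r)"
            by (intro sum.cong) (auto simp: q_def)
          also have "q j + \<dots> = ((1 - \<theta>) + (real r - 1) * (1 + \<theta> / (real r - 1))) / r"
            using j r1(2) unfolding add_divide_distrib[of "1 - \<theta>"] by (simp add: q_def)
          also have "\<dots> = 1" using r1 r0 by (simp add: field_simps)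
          finally show "(\<Sum>i<r. q i) \<le> 1" by simp
          show "finite Y" using Y fW by (auto intro: finite_subset)
          define m where "m = k' j - t"
          define g where "g = 1 + \<theta> / (real r - 1)"
          have g: "1 \<le> g" unfolding g_def using \<theta> r1 by simp
          have "(\<Prod>i<r. (1 / q i) ^ ((k'(j := k' j - card T)) i))
              = (r / (1 - \<theta>)) ^ m * (\<Prod>i\<in>{..<r} - {j}. (1 / q i) ^ ((k'(j := k' j - card T)) i))"
            using j T(2) by (simp add: prod.remove[of "{..<r}" j] q_def m_def)
          also have "(\<Prod>i\<in>{..<r} - {j}. (1 / q i) ^ ((k'(j := k' j - card T)) i))
              = (\<Prod>i\<in>{..<r} - {j}. (r / g) ^ k' i)"
            by (intro prod.cong) (auto simp: q_def g_def)
          also have "\<dots> = (r / g) ^ A" by (simp add: power_sum A_def)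
          finally have P: "(\<Prod>i<r. (1 / q i) ^ ((k'(j := k' j - card T)) i))
              = real r ^ (m + A) * (1 / (1 - \<theta>)) ^ m / g ^ A"
            by (simp add: power_divide power_add)
          have "2 * (real r ^ (m + A) * (1 / (1 - \<theta>)) ^ m) * real r ^ t * real r ^ u
              = 2 * real r ^ (r * k) * (1 / (1 - \<theta>)) ^ m"
          proof -
            have "m + A + t + u = r * k" using kjA tk by (simp add: m_def)
            then have "real r ^ (r * k) = real r ^ (m + A) * real r ^ t * real r ^ u"
              by (simp flip: power_add)
            then show ?thesis by (simp only: ac_simps)
          qed
          also have "\<dots> \<le> 2 * real r ^ (r * k) * (1 / (1 - \<theta>)) ^ (k - t)"
            using \<theta> Suc.prems(4)[OF j]
            by (intro mult_left_mono power_increasing) (auto simp: m_def field_simps)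
          also have "\<dots> \<le> (p0 - \<delta>) ^ (t + b) * real r ^ t * g ^ ((r - 1) * k - S) * card V"
            using gain[OF b] by (simp add: g_def)
          also have "\<dots> \<le> (p0 - \<delta>) ^ (t + b) * real r ^ t * g ^ A * (real r ^ u * card W)"
          proof (rule mult_mono)
            show "(p0 - \<delta>) ^ (t + b) * real r ^ t * g ^ ((r - 1) * k - S)
                \<le> (p0 - \<delta>) ^ (t + b) * real r ^ t * g ^ A"
              using g A2 \<delta> by (intro mult_left_mono power_increasing) auto
            have "1 * real (card V) \<le> (1 + \<epsilon>) ^ u * card V"
              using \<epsilon> by (intro mult_right_mono one_le_power) auto
            also have "\<dots> = real r ^ u * (((1 + \<epsilon>) / r) ^ u * card V)" using r0 by (simp add: power_divide)
            also have "\<dots> \<le> real r ^ u * real (card W)" using Suc.prems(3) by (intro mult_left_mono) auto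
            finally show "real (card V) \<le> real r ^ u * card W" by simp
          qed (use g \<delta> in auto)
          also have "\<dots> = ((p0 - \<delta>) ^ (t + b) * card W) * g ^ A * real r ^ t * real r ^ u"
            by (simp only: ac_simps)
          finally have "2 * (real r ^ (m + A) * (1 / (1 - \<theta>)) ^ m)
              \<le> ((p0 - \<delta>) ^ (t + b) * card W) * g ^ A"
            using r0 by (simp only: mult_le_cancel_right_pos zero_less_power)
          also have "\<dots> \<le> card Y * g ^ A" using Yc g by (intro mult_right_mono) auto
          finally have "2 * (real r ^ (m + A) * (1 / (1 - \<theta>)) ^ m) / g ^ A \<le> card Y"
            using g by (simp add: divide_le_eq)
          then show "2 * (\<Prod>i<r. (1 / q i) ^ ((k'(j := k' j - card T)) i)) \<le> card Y + 1"
            unfolding P by simp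
        qed
      qed (use T Y tk fW in \<open>auto intro: finite_subset\<close>)
    qed
  qed
  show ?thesis by (rule main[of 0]) auto
qed

section \<open>The choice of parameters\<close>

lemma half_le_ln_one_plus:
  assumes "0 \<le> y" "y \<le> (1::real)"
  shows "y / 2 \<le> ln (1 + y)"
proof -
  have "exp (y / 2) \<le> 1 + y / 2 + (y / 2)\<^sup>2" using assms by (intro exp_bound) auto
  also have "(y / 2)\<^sup>2 \<le> y / 2"
    using mult_mono[of y 1 y y] assms by (simp add: power2_eq_square)
  finally have "exp (y / 2) \<le> 1 + y" by simp
  then show ?thesis using assms by (subst ln_ge_iff) auto
qed

lemma half_le_ln_2: "1 / 2 \<le> ln (2::real)"
  using half_le_ln_one_plus[of 1] by simp

lemma ex_power_2_between:
  assumes "1 \<le> (x::real)"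
  obtains n where "x \<le> 2 ^ n" "2 ^ n \<le> 2 * x"
proof -
  obtain m where "x < 2 ^ m" using real_arch_pow[of 2 x] by auto
  then have ex: "x \<le> 2 ^ m" by simp
  define n where "n = (LEAST n. x \<le> 2 ^ n)"
  have n: "x \<le> 2 ^ n" unfolding n_def by (rule LeastI[of "\<lambda>n. x \<le> 2 ^ n", OF ex])
  have "2 ^ n \<le> 2 * x"
  proof (cases n)
    case (Suc n')
    then have "\<not> x \<le> 2 ^ n'" using not_less_Least[of n' "\<lambda>n. x \<le> 2 ^ n"] by (simp add: n_def)
    then show ?thesis using Suc by simp
  qed (use assms in simp)
  with n that show thesis by blast
qed

lemma square_le_power_2: "(real s + 3)\<^sup>2 \<le> 16 * 2 ^ s"
proof (induction s)
  case (Suc s)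
  show ?case
  proof (cases "s = 0")
    case False
    then have "1 \<le> real s" by simp
    then have "1 * 1 \<le> real s * real s" by (intro mult_mono) auto
    then have "(real (Suc s) + 3)\<^sup>2 \<le> 2 * (real s + 3)\<^sup>2"
      by (simp add: power2_eq_square algebra_simps)
    with Suc show ?thesis by simp
  qed simp
qed simp

locale ramsey_parameters =
  fixes r k :: nat and l :: real
  assumes r: "2 \<le> r" and l: "l = ln (2 * real r)" and k: "2 ^ 70 * real r ^ 2 * l ^ 6 \<le> real k"
begin

text \<open>The order k/(r l^2) is dictated by \<open>size_exponent\<close>: r t colour steps at a
  price of order r l^3 each must fit into a fraction of r k l.\<close>

definition t :: nat where "t = nat \<lfloor>real k / (2 ^ 24 * real r * l ^ 2)\<rfloor>"
text \<open>Large enough that \<open>S\<close> increments by 1 + \<epsilon> make up for the deficit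
  \<Gamma>, and small enough that the vertices they take from the other colours cost at most
  t\<theta>/4 in \<open>weight_gain\<close>.\<close>

definition S :: nat where "S = nat \<lfloor>real r * real t / 8\<rfloor>"
definition kk :: nat where "kk = nat \<lceil>l\<rceil>"
text \<open>With 2^s0 of order r l^4 each colour has O(t/(r l^3)) boosts. At a price of at most
  \<open>l\<close> each, they lose O(t/(r l^2)) in the exponent.\<close>

definition s0 :: nat where "s0 = (SOME n. 2 ^ 40 * real r * l ^ 4 \<le> 2 ^ n \<and> 2 ^ n \<le> 2 * (2 ^ 40 * real r * l ^ 4))"
text \<open>Relative deviation of the densities from 1/r. Over \<open>t\<close> steps it costs order
  t\<eta>, which the constant makes small compared with the gain t\<theta>.\<close>

definition \<eta> :: real where "\<eta> = 1 / (2 ^ 35 * real r * l ^ 2)"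
definition \<epsilon> :: real where "\<epsilon> = \<eta> / real r"
text \<open>The 16 makes the second-order loss k\<theta>^2 equal to t\<theta>/16.\<close>

definition \<theta> :: real where "\<theta> = real t / (16 * real k)"
definition p0 :: real where "p0 = (1 - \<epsilon> * real r) / real r"
definition \<delta> :: real where "\<delta> = \<eta> * p0"
definition \<Gamma> :: real where "\<Gamma> = 1 / 2 ^ 67 * (real k / (real r ^ 2 * l ^ 4))"

section \<open>Numerical bounds for the chosen parameters\<close>

lemma r_ge: "2 \<le> real r" using r by simp

lemma ln_2_le: "2 * ln 2 \<le> l"
proof -
  have "2 * ln (2::real) = ln (2 ^ 2)" by (subst ln_realpow) auto
  also have "\<dots> \<le> l" unfolding l using r_ge by (intro ln_mono) auto
  finally show ?thesis .
qed

lemma l_ge: "1 \<le> l" using ln_2_le half_le_ln_2 by linarith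

lemma ln_r: "0 \<le> ln (real r)" "ln (real r) \<le> l" "l / 2 \<le> ln (real r)" "l = ln 2 + ln (real r)"
proof -
  show e: "l = ln 2 + ln (real r)" unfolding l using r_ge by (subst ln_mult) auto
  have "ln 2 \<le> ln (real r)" using r_ge by (intro ln_mono) auto
  with e half_le_ln_2 show "0 \<le> ln (real r)" "ln (real r) \<le> l" "l / 2 \<le> ln (real r)" by linarith+
qed

lemma ln_l: "ln l \<le> l" "0 \<le> ln l"
  using ln_le_minus_one[of l] l_ge by auto

lemma l_pow: "1 \<le> l ^ n" using l_ge by (rule one_le_power)

lemma rl: "1 \<le> real r * l ^ n"
  using mult_mono[of 1 "real r" 1 "l ^ n"] r_ge l_pow[of n] by simp

lemma k_pos: "0 < real k"
proof -
  have "0 < 2 ^ 70 * real r ^ 2 * l ^ 6" using r_ge l_ge by simp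
  with k show ?thesis by linarith
qed

text \<open>The lower bound of order r l^4 is where the assumption k \<ge> 2^70 r^2 l^6 enters. It
  places 2^s0 below \<open>t\<close>, so that a boost at scale \<open>s0\<close> is still in the
  linear range of the logarithm.\<close>

lemma t_bounds: "2 ^ 24 * (real r * l ^ 2) * t \<le> k" "k \<le> 2 ^ 25 * (real r * l ^ 2) * t"
  "2 ^ 45 * (real r * l ^ 4) \<le> t"
proof -
  define d where "d = 2 ^ 24 * (real r * l ^ 2)"
  define x where "x = real k / d"
  have d: "0 < d" unfolding d_def using rl[of 2] by simp
  have tx: "t = nat \<lfloor>x\<rfloor>" by (simp add: t_def x_def d_def mult.assoc)
  have "2 ^ 46 * (real r * l ^ 4) * d \<le> 2 ^ 70 * real r ^ 2 * l ^ 6"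
    using r_ge l_ge by (simp add: d_def power2_eq_square numeral_eq_Suc)
  also note k
  finally have x46: "2 ^ 46 * (real r * l ^ 4) \<le> x" unfolding x_def using d by (simp add: pos_le_divide_eq)
  then have x2: "2 \<le> x" using rl[of 4] by simp
  have t1: "real t \<le> x" unfolding tx using x2 by linarith
  have t2: "x / 2 \<le> real t" unfolding tx using x2 by linarith
  have xd: "x * d = k" using d by (simp add: x_def)
  have "real t * d \<le> x * d" using t1 d by (intro mult_right_mono) auto
  then have "d * real t \<le> k" using xd by (simp add: mult.commute)
  then show "2 ^ 24 * (real r * l ^ 2) * t \<le> k" unfolding d_def .
  have "x / 2 * d \<le> real t * d" using t2 d by (intro mult_right_mono) auto
  then have "k \<le> 2 * d * real t" using xd by (simp add: mult.commute)
  then show "k \<le> 2 ^ 25 * (real r * l ^ 2) * t" unfolding d_def by simp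
  show "2 ^ 45 * (real r * l ^ 4) \<le> t" using t2 x46 by simp
qed

lemma t_ge: "100 \<le> real t" using t_bounds(3) rl[of 4] by simp

lemma s0_bounds: "2 ^ 40 * (real r * l ^ 4) \<le> 2 ^ s0" "2 ^ s0 \<le> 2 ^ 41 * (real r * l ^ 4)"
proof -
  have "1 \<le> 2 ^ 40 * real r * l ^ 4" using rl[of 4] by simp
  then have "\<exists>n. 2 ^ 40 * real r * l ^ 4 \<le> 2 ^ n \<and> 2 ^ n \<le> 2 * (2 ^ 40 * real r * l ^ 4)"
    by (metis ex_power_2_between)
  from someI_ex[OF this] show "2 ^ 40 * (real r * l ^ 4) \<le> 2 ^ s0" "2 ^ s0 \<le> 2 ^ 41 * (real r * l ^ 4)"
    unfolding s0_def by simp_all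
qed

lemma s0_le: "2 ^ s0 \<le> real t" 
  by (rule order_trans[OF s0_bounds(2) order_trans[OF _ t_bounds(3)]]) (use rl[of 4] in simp)

lemma eta: "0 < \<eta>" "\<eta> \<le> 1 / 2 ^ 35" "\<eta> * (2 ^ 35 * (real r * l ^ 2)) = 1" "\<eta> * l \<le> 1 / 2 ^ 35"
proof -
  have d: "0 < real r * l ^ 2" using rl[of 2] by linarith
  show "0 < \<eta>" using d by (simp add: \<eta>_def mult.assoc)
  have "l \<le> l ^ 2" using l_ge by (simp add: power2_eq_square)
  also have "1 * l ^ 2 \<le> real r * l ^ 2" using r_ge by (intro mult_right_mono) auto
  finally have "l \<le> real r * l ^ 2" by simp
  then show "\<eta> * l \<le> 1 / 2 ^ 35" using d by (simp add: \<eta>_def mult.assoc field_simps)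
  show "\<eta> \<le> 1 / 2 ^ 35" using rl[of 2] d by (simp add: \<eta>_def mult.assoc field_simps)
  show "\<eta> * (2 ^ 35 * (real r * l ^ 2)) = 1"
    using r_ge l_ge by (simp add: \<eta>_def mult.assoc)
qed

lemma er: "\<epsilon> * real r = \<eta>" using r_ge by (simp add: \<epsilon>_def)

lemma p0_eq: "p0 = (1 - \<eta>) / real r" by (simp add: p0_def er)

lemma delta: "0 < \<delta>" "\<delta> < p0" "p0 - \<delta> = (1 - \<eta>)\<^sup>2 / real r"
proof -
  have p: "0 < p0" unfolding p0_eq using eta r_ge by simp
  then show "0 < \<delta>" "\<delta> < p0" using eta by (simp_all add: \<delta>_def)
  show "p0 - \<delta> = (1 - \<eta>)\<^sup>2 / real r" by (simp add: \<delta>_def p0_eq power2_eq_square algebra_simps add_divide_distrib diff_divide_distrib)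
qed

lemma ln_p: "- ln (p0 - \<delta>) \<le> ln (real r) + 4 * \<eta>" "- ln (p0 - \<delta>) \<le> l"
proof -
  have e: "- \<eta> - 2 * \<eta>\<^sup>2 \<le> ln (1 - \<eta>)"
    using eta by (intro ln_one_minus_pos_lower_bound) auto
  have "2 * \<eta>\<^sup>2 \<le> \<eta>" using eta by (simp add: power2_eq_square)
  with e have "- ln (1 - \<eta>) \<le> 2 * \<eta>" by linarith
  moreover have "ln (p0 - \<delta>) = 2 * ln (1 - \<eta>) - ln (real r)"
    unfolding delta(3) using eta r_ge by (simp add: ln_div ln_realpow)
  ultimately show "- ln (p0 - \<delta>) \<le> ln (real r) + 4 * \<eta>" by linarith
  also have "\<dots> \<le> l" using ln_r(4) half_le_ln_2 eta(2) by simp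
  finally show "- ln (p0 - \<delta>) \<le> l" .
qed

lemma nine_delta: "9 / \<delta> \<le> 2 ^ 40 * (real r ^ 2 * l ^ 2)" "ln (9 / \<delta>) \<le> 32 * l" "0 < 9 / \<delta>"
proof -
  define R where "R = real r * (real r * l ^ 2)"
  have R: "0 < R" using r_ge rl[of 2] by (simp add: R_def)
  have d: "\<delta> * (2 ^ 35 * R) = 1 - \<eta>"
    using eta(3) r_ge unfolding \<delta>_def p0_eq R_def by (simp add: field_simps)
  then have "9 * 1 \<le> 2 ^ 40 * R * \<delta>"
    using eta(2) by (simp add: field_simps)
  then have "9 / \<delta> \<le> 2 ^ 40 * R" using delta by (simp add: divide_le_eq)
  then show le: "9 / \<delta> \<le> 2 ^ 40 * (real r ^ 2 * l ^ 2)" by (simp add: R_def power2_eq_square mult.assoc)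
  show p: "0 < 9 / \<delta>" using delta by simp
  have "ln (9 / \<delta>) \<le> ln (2 ^ 40 * (real r ^ 2 * l ^ 2))" using le p by (intro ln_mono) auto
  also have "\<dots> = ln (2 ^ 40) + (ln (real r ^ 2) + ln (l ^ 2))"
    using r_ge l_ge by (subst ln_mult, simp, simp, subst ln_mult) auto
  also have "\<dots> = 40 * ln 2 + (2 * ln (real r) + 2 * ln l)"
    using r_ge l_ge by (subst (1 2 3) ln_realpow) auto
  also have "\<dots> \<le> 32 * l" using ln_2_le ln_r ln_l l_ge by linarith
  finally show "ln (9 / \<delta>) \<le> 32 * l" .
qed

lemma kk_bounds: "4 * real r \<le> 9 ^ kk" "real kk \<le> 2 * l"
proof -
  have "l \<le> real kk" unfolding kk_def by (rule real_nat_ceiling_ge)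
  have e2: "exp (2::real) \<le> 9"
  proof -
    have "exp (2::real) = exp 1 * exp 1" by (simp flip: exp_add)
    also have "\<dots> \<le> 3 * 3" using exp_le by (intro mult_mono) auto
    finally show ?thesis by simp
  qed
  have "4 * real r \<le> (2 * real r) ^ 2"
    using mult_mono[of 1 "real r" 4 "4 * real r"] r_ge by (simp add: power2_eq_square)
  also have "2 * real r = exp l" unfolding l using r_ge by simp
  also have "exp l ^ 2 \<le> exp (real kk) ^ 2" using \<open>l \<le> real kk\<close> by (intro power_mono) auto
  also have "\<dots> = exp 2 ^ kk" by (simp add: mult.commute flip: exp_of_nat_mult)
  also have "\<dots> \<le> 9 ^ kk" using e2 by (intro power_mono) auto
  finally show "4 * real r \<le> 9 ^ kk" .
  show "real kk \<le> 2 * l" unfolding kk_def using l_ge by linarith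
qed

lemma step_cost:
  "real (3 * kk * r * n\<^sup>2) * ln 2 \<le> 6 * (real r * l) * (real n)\<^sup>2"
proof -
  have "real (3 * kk * r * n\<^sup>2) * ln 2 = (3 * real kk * ln 2) * (real r * (real n)\<^sup>2)" by simp
  also have "\<dots> \<le> (3 * (2 * l) * 1) * (real r * (real n)\<^sup>2)"
    using kk_bounds l_ge ln_2_less_1 by (intro mult_right_mono mult_mono) auto
  finally show ?thesis by (simp add: ac_simps)
qed

text \<open>Two regimes. For 2^s \<le> t the logarithm is at least 2^s/(2t), and 2^s beats the
  quadratic (s + 3)^2. For larger \<open>s\<close> the logarithm is merely at least 1/2, but
  9/\<delta> \<le> t^2 gives 2^s \<le> t^3, so (s + 3)^2 is O(t).\<close>

lemma cost:
  assumes s: "s0 \<le> s" and le: "2 ^ s \<le> 9 * real t / \<delta>"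
  shows "real (3 * kk * r * (s + 3)\<^sup>2) * ln 2 \<le> real k / 256 * ln (1 + 2 ^ s / real t)"
proof -
  have t0: "0 < real t" using t_ge by linarith
  have g0: "0 \<le> ln (1 + 2 ^ s / real t)" using t0 by (intro ln_ge_zero) auto
  have main: "(real s + 3)\<^sup>2 \<le> 288 * (real t * ln (1 + 2 ^ s / real t))"
  proof (cases "2 ^ s \<le> real t")
    case True
    then have "2 ^ s / real t / 2 \<le> ln (1 + 2 ^ s / real t)"
      using t0 by (intro half_le_ln_one_plus) auto
    then have "real t * (2 ^ s / real t / 2) \<le> real t * ln (1 + 2 ^ s / real t)"
      using t0 by (intro mult_left_mono) auto
    then have "2 ^ s / 2 \<le> real t * ln (1 + 2 ^ s / real t)" using t0 by simp
    then have "16 * 2 ^ s \<le> 32 * (real t * ln (1 + 2 ^ s / real t))" by simp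
    also have "\<dots> \<le> 288 * (real t * ln (1 + 2 ^ s / real t))"
      using g0 t0 by (intro mult_right_mono) auto
    finally show ?thesis by (rule order_trans[OF square_le_power_2])
  next
    case False
    have "1 + 1 \<le> 1 + 2 ^ s / real t" using False t0 by simp
    then have "ln 2 \<le> ln (1 + 2 ^ s / real t)" by (intro ln_mono) auto
    then have "1 / 2 \<le> ln (1 + 2 ^ s / real t)" using half_le_ln_2 by linarith
    then have "real t * (1 / 2) \<le> real t * ln (1 + 2 ^ s / real t)"
      using t0 by (intro mult_left_mono) auto
    moreover have "(real s + 3)\<^sup>2 \<le> 144 * real t"
    proof -
      obtain m where m: "real t \<le> 2 ^ m" "2 ^ m \<le> 2 * real t"
        using ex_power_2_between[of "real t"] t_ge by auto
      have "2 ^ s \<le> 9 / \<delta> * real t" using le by simp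
      also have "\<dots> \<le> 2 ^ 40 * (real r ^ 2 * l ^ 2) * real t"
        using nine_delta(1) t0 by (intro mult_right_mono) auto
      also have "\<dots> \<le> real t ^ 2 * real t"
      proof (intro mult_right_mono)
        define y where "y = real r * l ^ 4"
        have "real r * l \<le> y" using r_ge l_ge power_increasing[of 1 4 l] by (simp add: y_def)
        then have "(real r * l) ^ 2 \<le> y ^ 2" using r_ge l_ge by (intro power_mono) auto
        also have "\<dots> = (1 * y) ^ 2" by simp
        finally have "2 ^ 40 * (real r ^ 2 * l ^ 2) \<le> 2 ^ 40 * y ^ 2" by (simp add: power_mult_distrib)
        also have "\<dots> \<le> (2 ^ 45 * y) ^ 2" by (simp add: power_mult_distrib)
        also have "\<dots> \<le> real t ^ 2"
          using t_bounds(3) rl[of 4] unfolding y_def by (intro power_mono) auto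
        finally show "2 ^ 40 * (real r ^ 2 * l ^ 2) \<le> real t ^ 2" .
      qed (use t0 in simp)
      also have "\<dots> = real t ^ 3" by (simp add: power2_eq_square power3_eq_cube)
      also have "\<dots> \<le> (2 ^ m) ^ 3" using m t0 by (intro power_mono) auto
      also have "\<dots> = 2 ^ (3 * m)" by (simp add: mult.commute flip: power_mult)
      finally have "s \<le> 3 * m" by (simp add: power_le_imp_le_exp)
      have m1: "1 \<le> m"
      proof (rule ccontr)
        assume "\<not> 1 \<le> m"
        then show False using m t_ge by (simp add: not_le)
      qed
      then have "real s + 3 \<le> 3 * (real (m - 1) + 3)" using \<open>s \<le> 3 * m\<close> by (simp add: of_nat_diff)
      then have "(real s + 3)\<^sup>2 \<le> (3 * (real (m - 1) + 3))\<^sup>2" by (intro power_mono) auto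
      also have "\<dots> = 9 * (real (m - 1) + 3)\<^sup>2" by (simp only: power_mult_distrib) simp
      also have "\<dots> \<le> 9 * (16 * 2 ^ (m - 1))" using square_le_power_2[of "m - 1"] by simp
      also have "\<dots> = 72 * 2 ^ m" using m1 by (cases m) auto
      also have "\<dots> \<le> 72 * (2 * real t)" using m by (intro mult_left_mono) auto
      finally show ?thesis by simp
    qed
    ultimately show ?thesis by simp
  qed
  have "real (3 * kk * r * (s + 3)\<^sup>2) * ln 2 \<le> (real r * l) * (6 * (real s + 3)\<^sup>2)"
    using step_cost[of "s + 3"] by (simp add: ac_simps)
  also have "\<dots> \<le> (real r * l) * (6 * (288 * (real t * ln (1 + 2 ^ s / real t))))"
    using main r_ge l_ge by (intro mult_left_mono) auto
  also have "\<dots> \<le> (real r * l) * (2 ^ 16 * (real t * ln (1 + 2 ^ s / real t)))"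
    using g0 t0 r_ge l_ge by (intro mult_left_mono) auto
  also have "\<dots> \<le> (real r * l ^ 2) * (2 ^ 16 * (real t * ln (1 + 2 ^ s / real t)))"
    using r_ge l_ge g0 t0 by (intro mult_right_mono mult_left_mono) (auto simp: power2_eq_square)
  also have "\<dots> = 2 ^ 24 * (real r * l ^ 2) * t / 256 * ln (1 + 2 ^ s / real t)" by simp
  also have "\<dots> \<le> real k / 256 * ln (1 + 2 ^ s / real t)"
    using t_bounds(1) g0 by (intro mult_right_mono divide_right_mono) auto
  finally show ?thesis .
qed

text \<open>The unit in which gains and losses in the exponent are compared: t\<eta> is 64u, the
  boosts lose at most 128u, \<Gamma> + 2 is at most u, and t\<theta> is at least 4096u.\<close>

definition u :: real where "u = real t / (2 ^ 41 * (real r * l ^ 2))"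

lemma u_eqs: "0 < u" "real t = 2 ^ 41 * (real r * l ^ 2) * u" "\<eta> * t = 64 * u"
proof -
  have d: "0 < real r * l ^ 2" using rl[of 2] by linarith
  then show "0 < u" using t_ge by (simp add: u_def)
  show e: "real t = 2 ^ 41 * (real r * l ^ 2) * u" using r_ge l_ge by (simp add: u_def)
  have "\<eta> * t = 64 * u * (\<eta> * (2 ^ 35 * (real r * l ^ 2)))" unfolding e by simp
  then show "\<eta> * t = 64 * u" unfolding eta(3) by simp
qed

lemma Gamma_le: "0 < \<Gamma>" "\<Gamma> + 2 \<le> u" "\<Gamma> \<le> k / 16"
proof -
  have R: "1 \<le> real r ^ 2 * l ^ 4"
    using mult_mono[of 1 "real r ^ 2" 1 "l ^ 4"] r_ge l_pow[of 4] by (simp add: one_le_power)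
  show "0 < \<Gamma>" using k_pos R by (simp add: \<Gamma>_def)
  have "real k / (real r ^ 2 * l ^ 4) \<le> real k / 1" using R k_pos by (intro divide_left_mono) auto
  then have "\<Gamma> \<le> 1 / 2 ^ 67 * real k" unfolding \<Gamma>_def by (intro mult_left_mono) auto
  also have "\<dots> \<le> k / 16" using k_pos by simp
  finally show "\<Gamma> \<le> k / 16" .
  have d: "0 < real r * l ^ 2" using rl[of 2] by linarith
  have "real k \<le> 2 ^ 25 * (real r * l ^ 2) * (2 ^ 41 * (real r * l ^ 2) * u)"
    using t_bounds(2) unfolding u_eqs(2) .
  also have "\<dots> = 2 ^ 66 * u * (real r ^ 2 * l ^ 4)" by (simp add: power2_eq_square power4_eq_xxxx)
  finally have "real k / (real r ^ 2 * l ^ 4) \<le> 2 ^ 66 * u" using R by (simp add: divide_le_eq)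
  then have "\<Gamma> \<le> 1 / 2 ^ 67 * (2 ^ 66 * u)" unfolding \<Gamma>_def by (intro mult_left_mono) auto
  then have g: "\<Gamma> \<le> u / 2" by simp
  have "2 ^ 45 * l ^ 2 * (real r * l ^ 2) = 2 ^ 45 * (real r * l ^ 4)"
    by (simp add: power2_eq_square power4_eq_xxxx)
  also have "\<dots> \<le> 2 ^ 41 * u * (real r * l ^ 2)" using t_bounds(3) unfolding u_eqs(2) by (simp add: ac_simps)
  finally have "2 ^ 45 * l ^ 2 \<le> 2 ^ 41 * u" using d by (simp only: mult_le_cancel_right_pos)
  then have "16 * l ^ 2 \<le> u" by simp
  then show "\<Gamma> + 2 \<le> u" using g l_pow[of 2] by linarith
qed

lemma rt_le_k: "2 ^ 24 * (real r * t) \<le> k"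
proof -
  have "2 ^ 24 * (real r * t) * 1 \<le> 2 ^ 24 * (real r * t) * l ^ 2"
    using l_pow[of 2] by (intro mult_left_mono) auto
  with t_bounds(1) show ?thesis by (simp add: ac_simps)
qed

lemma S_bounds: "real S \<le> real r * t / 8" "real r * t / 16 \<le> real S" "S + t \<le> k"
proof -
  have rt: "200 \<le> real r * t" using mult_mono[of 2 "real r" 100 "real t"] r_ge t_ge by simp
  then show S1: "real S \<le> real r * t / 8" unfolding S_def by linarith
  show "real r * t / 16 \<le> real S" unfolding S_def using rt by linarith
  have "1 * real t \<le> real r * t" using r_ge by (intro mult_right_mono) auto
  then have "real S + t \<le> k" using S1 rt_le_k rt by simp
  then show "S + t \<le> k" by linarith
qed

lemma theta: "0 < \<theta>" "\<theta> \<le> 1 / 2" "k * \<theta> = t / 16" "4096 * u \<le> t * \<theta>"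
proof -
  show "0 < \<theta>" using k_pos t_ge by (simp add: \<theta>_def)
  show kt: "k * \<theta> = t / 16" using k_pos by (simp add: \<theta>_def)
  have "real t \<le> k" using S_bounds(3) by simp
  then show "\<theta> \<le> 1 / 2" using k_pos by (simp add: \<theta>_def divide_le_eq)
  have d: "0 < real r * l ^ 2" using rl[of 2] by linarith
  have "4096 * u * k \<le> 4096 * u * (2 ^ 25 * (real r * l ^ 2) * t)"
    using t_bounds(2) u_eqs(1) by (intro mult_left_mono) auto
  also have "\<dots> = (2 ^ 41 * (real r * l ^ 2) * u) * t / 16" by simp
  also have "\<dots> = real t * real t / 16" unfolding u_eqs(2)[symmetric] ..
  also have "\<dots> = real t * (k * \<theta>)" using kt by simp
  finally have "4096 * u * k \<le> t * \<theta> * k" by (simp add: ac_simps)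
  then show "4096 * u \<le> t * \<theta>" using k_pos by (simp only: mult_le_cancel_right_pos)
qed

text \<open>Each boost contributes at least 2^s0/(2t) to a total of at most 32 l. The factor
  \<open>l\<close> in the conclusion is the logarithmic price of a boost, bounded in
  \<open>ln_p\<close>.\<close>

lemma boost_count:
  assumes "real b * ln (1 + 2 ^ s0 / real t) \<le> ln (9 / \<delta>)"
  shows "real b * l \<le> 128 * u"
proof -
  have t0: "0 < real t" using t_ge by linarith
  define y where "y = 2 ^ s0 / real t"
  have y: "0 \<le> y" "y \<le> 1" using s0_le t0 by (auto simp: y_def)
  have "real b * (y / 2) \<le> real b * ln (1 + y)"
    using half_le_ln_one_plus[OF y] by (intro mult_left_mono) auto
  also have "\<dots> \<le> 32 * l" using assms nine_delta(2) unfolding y_def by linarith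
  finally have "real b * y \<le> 64 * l" by simp
  then have "real b * 2 ^ s0 \<le> 64 * l * t" using t0 by (simp add: y_def divide_le_eq)
  moreover have "real b * (2 ^ 40 * (real r * l ^ 4)) \<le> real b * 2 ^ s0"
    using s0_bounds by (intro mult_left_mono) auto
  ultimately have "real b * (2 ^ 40 * (real r * l ^ 4)) \<le> 64 * l * t" by linarith
  also have "\<dots> = 64 * l * (2 ^ 41 * (real r * l ^ 2) * u)" using u_eqs(2) by simp
  finally have "real b * l * (2 ^ 40 * (real r * l ^ 3)) \<le> 128 * u * (2 ^ 40 * (real r * l ^ 3))"
    by (simp add: power2_eq_square power3_eq_cube power4_eq_xxxx)
  moreover have "0 < 2 ^ 40 * (real r * l ^ 3)" using rl[of 3] by simp
  ultimately show ?thesis by (simp only: mult_le_cancel_right_pos)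
qed

text \<open>The terms k\<theta> of both sides cancel and t\<theta> remains. From it the second-order
  terms take t\<theta>/8 and t\<theta>/16, and the \<open>S\<close> vertices spent earlier take
  t\<theta>/4, so more than t\<theta>/2 \<ge> 2048u survives.\<close>

lemma weight_gain:
  "(real k - t) * - ln (1 - \<theta>) + 2048 * u
    \<le> ((real r - 1) * k - S) * ln (1 + \<theta> / (real r - 1))"
proof -
  define y where "y = \<theta> / (real r - 1)"
  have r1: "1 \<le> real r - 1" using r_ge by simp
  have y: "0 < y" "y \<le> \<theta>" "(real r - 1) * y = \<theta>"
    using theta r1 by (auto simp: y_def divide_le_eq)
  have kt: "real t \<le> k" using S_bounds(3) by simp
  have "- ln (1 - \<theta>) \<le> \<theta> + 2 * \<theta>\<^sup>2"
    using ln_one_minus_pos_lower_bound[of \<theta>] theta by simp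
  then have "(real k - t) * - ln (1 - \<theta>) \<le> (real k - t) * (\<theta> + 2 * \<theta>\<^sup>2)"
    using kt by (intro mult_left_mono) auto
  also have "\<dots> = k * \<theta> - t * \<theta> + (real k - t) * (2 * \<theta>\<^sup>2)" by (simp add: algebra_simps)
  also have "\<dots> \<le> k * \<theta> - t * \<theta> + k * (2 * \<theta>\<^sup>2)"
    by (intro add_left_mono mult_right_mono) auto
  also have "k * (2 * \<theta>\<^sup>2) = t * \<theta> / 8" using theta(3) by (simp add: power2_eq_square)
  finally have A: "(real k - t) * - ln (1 - \<theta>) \<le> k * \<theta> - t * \<theta> + t * \<theta> / 8" .
  have "real S \<le> k" using S_bounds(3) by simp
  also have "1 * real k \<le> (real r - 1) * k" using r1 by (intro mult_right_mono) auto
  finally have Sk: "real S \<le> (real r - 1) * k" by simp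
  have "y - y\<^sup>2 \<le> ln (1 + y)"
    using y theta by (intro ln_one_plus_pos_lower_bound) auto
  then have B: "((real r - 1) * k - S) * (y - y\<^sup>2) \<le> ((real r - 1) * k - S) * ln (1 + y)"
    using Sk by (intro mult_left_mono) auto
  have "((real r - 1) * k - S) * (y - y\<^sup>2) = k * ((real r - 1) * y) - S * y - ((real r - 1) * y) * k * y + S * y\<^sup>2"
    by (simp add: algebra_simps power2_eq_square)
  then have "((real r - 1) * k - S) * (y - y\<^sup>2) = k * \<theta> - S * y - k * \<theta> * y + S * y\<^sup>2"
    unfolding y(3) by simp
  moreover have "k * \<theta> * y \<le> k * \<theta> * \<theta>" using y theta by (intro mult_left_mono) auto
  moreover have "k * \<theta> * \<theta> = t * \<theta> / 16" using theta(3) by simp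
  moreover have "0 \<le> S * y\<^sup>2" by simp
  moreover have "S * y \<le> t * \<theta> / 4"
  proof -
    have "S * y \<le> (real r * t / 8) * y" using S_bounds(1) y by (intro mult_right_mono) auto
    also have "\<dots> \<le> (2 * (real r - 1)) * t / 8 * y" using r1 y by (intro mult_right_mono divide_right_mono) auto
    also have "\<dots> = t * ((real r - 1) * y) / 4" by simp
    finally show ?thesis unfolding y(3) .
  qed
  ultimately have "k * \<theta> - t * \<theta> / 4 - t * \<theta> / 16 \<le> ((real r - 1) * k - S) * (y - y\<^sup>2)" by linarith
  with A B theta(4) u_eqs(1) show ?thesis unfolding y_def by linarith
qed

text \<open>Half of the allowance r k l/4 goes to the colour steps and half to the boosts. The
  second half explains the price G = k/256, since ln (9/\<delta>) is at most 32 l.\<close>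

lemma size_exponent:
  "(ln (2 * real r) + real (3 * kk * r * (s0 + 2)\<^sup>2) * ln 2) * (real r * real t)
    + real k / 256 * (real r * ln (9 / \<delta>)) \<le> real r * k * l / 4"
proof -
  have "(real s0 + 2) * ln 2 = ln (2 ^ s0 * 4)"
    by (simp add: ln_mult ln_realpow algebra_simps) (use ln_realpow[of "2::real" 2] in simp)
  also have "\<dots> \<le> ln (2 ^ 43 * (real r * l ^ 4))"
    using s0_bounds(2) by (intro ln_mono) auto
  also have "\<dots> = ln (2 ^ 43) + (ln (real r) + ln (l ^ 4))"
    using r_ge l_ge by (subst ln_mult, simp, simp, subst ln_mult) auto
  also have "\<dots> = 43 * ln 2 + (ln (real r) + 4 * ln l)"
    using r_ge l_ge by (subst (1 2) ln_realpow) auto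
  also have "\<dots> \<le> 27 * l" using ln_2_le ln_r ln_l l_ge by linarith
  finally have "(real s0 + 2) * ln 2 \<le> 27 * l" .
  moreover have "(real s0 + 2) * (1 / 2) \<le> (real s0 + 2) * ln 2"
    using half_le_ln_2 by (intro mult_left_mono) auto
  ultimately have "(real s0 + 2) * (1 / 2) \<le> 27 * l" by linarith
  then have s: "real (s0 + 2) \<le> 64 * l" using l_ge by simp
  have "real (3 * kk * r * (s0 + 2)\<^sup>2) * ln 2 \<le> 6 * (real r * l) * (real (s0 + 2))\<^sup>2" by (rule step_cost)
  also have "\<dots> \<le> 6 * (real r * l) * (64 * l)\<^sup>2"
    using s r_ge l_ge by (intro mult_left_mono power_mono) auto
  also have "\<dots> = 24576 * (real r * l ^ 3)" by (simp add: power2_eq_square power3_eq_cube)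
  finally have "real (3 * kk * r * (s0 + 2)\<^sup>2) * ln 2 \<le> 24576 * (real r * l ^ 3)" .
  moreover have "ln (2 * real r) \<le> real r * l ^ 3"
  proof -
    have "1 * l ^ 1 \<le> real r * l ^ 3" using r_ge l_ge by (intro mult_mono power_increasing) auto
    then show ?thesis unfolding l[symmetric] by simp
  qed
  ultimately have "ln (2 * real r) + real (3 * kk * r * (s0 + 2)\<^sup>2) * ln 2 \<le> 24577 * (real r * l ^ 3)"
    by linarith
  then have "(ln (2 * real r) + real (3 * kk * r * (s0 + 2)\<^sup>2) * ln 2) * (real r * real t)
      \<le> 24577 * (real r * l ^ 3) * (real r * real t)"
    by (intro mult_right_mono) auto
  also have "\<dots> = 24577 / 2 ^ 24 * (real r * l) * (2 ^ 24 * (real r * l ^ 2) * t)"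
    by (simp add: power2_eq_square power3_eq_cube)
  also have "\<dots> \<le> 24577 / 2 ^ 24 * (real r * l) * k"
    using t_bounds(1) r_ge l_ge by (intro mult_left_mono) auto
  also have "\<dots> \<le> 1 / 8 * (real r * l) * k"
    using r_ge l_ge by (intro mult_right_mono) auto
  finally have A: "(ln (2 * real r) + real (3 * kk * r * (s0 + 2)\<^sup>2) * ln 2) * (real r * real t)
      \<le> real r * k * l / 8" by (simp add: ac_simps)
  have "real k / 256 * (real r * ln (9 / \<delta>)) \<le> real k / 256 * (real r * (32 * l))"
    using nine_delta(2) by (intro mult_left_mono) auto
  also have "\<dots> = real r * k * l / 8" by simp
  finally show ?thesis using A by linarith
qed

lemma r_div_epsilon: "real r / \<epsilon> \<le> real r * k * l / 4"
proof -
  have "real r / \<epsilon> = real r ^ 2 / \<eta>" using r_ge by (simp add: \<epsilon>_def power2_eq_square)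
  also have "\<dots> = 2 ^ 35 * real r ^ 3 * l ^ 2"
    by (simp add: \<eta>_def power2_eq_square power3_eq_cube)
  also have "\<dots> \<le> 2 ^ 68 * real r ^ 3 * l ^ 7"
    using l_ge r by (intro mult_mono power_increasing) auto
  also have "\<dots> = real r * l / 4 * (2 ^ 70 * real r ^ 2 * l ^ 6)"
    by (simp add: power2_eq_square power3_eq_cube numeral_eq_Suc)
  also have "\<dots> \<le> real r * l / 4 * k"
    using k r_ge l_ge by (intro mult_left_mono) auto
  finally show ?thesis by (simp add: ac_simps)
qed

section \<open>Vertex sets of nearly Erdos-Szekeres size\<close>

context
  fixes c :: "'a \<Rightarrow> 'a \<Rightarrow> nat" and V :: "'a set"
  assumes V: "finite V" and cV: "exp (- \<Gamma>) * real r ^ (r * k) \<le> 2 * card V"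
begin

text \<open>The factor 2 in the hypothesis on \<open>V\<close> leaves room for rounding the vertex
  number down to an integer; it costs less than 1 in the logarithm.\<close>

lemma ln_card: "r * k * ln (real r) - \<Gamma> - 1 \<le> ln (card V)" and card_pos: "0 < real (card V)"
proof -
  have p: "0 < exp (- \<Gamma>) * real r ^ (r * k)" using r_ge by simp
  then show "0 < real (card V)" using cV by linarith
  have "- \<Gamma> + r * k * ln (real r) = ln (exp (- \<Gamma>) * real r ^ (r * k))"
    using r_ge by (simp add: ln_mult ln_realpow)
  also have "\<dots> \<le> ln (2 * card V)" using cV p by (intro ln_mono) auto
  also have "\<dots> = ln 2 + ln (card V)" using \<open>0 < real (card V)\<close> by (simp add: ln_mult)
  finally show "r * k * ln (real r) - \<Gamma> - 1 \<le> ln (card V)" using ln_2_less_1 by linarith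
qed

lemma many: "2 * real r ^ (r * k) \<le> (1 + \<epsilon>) ^ S * card V"
proof -
  have e: "0 < \<epsilon>" "\<epsilon> \<le> 1" using eta r_ge by (auto simp: \<epsilon>_def divide_le_eq)
  have "real r * t / 16 * (\<epsilon> / 2) = (\<epsilon> * real r) * t / 32" by simp
  then have "2 * u = real r * t / 16 * (\<epsilon> / 2)" unfolding er u_eqs(3) by simp
  also have "\<dots> \<le> S * ln (1 + \<epsilon>)"
    using S_bounds half_le_ln_one_plus[of \<epsilon>] e by (intro mult_mono) auto
  finally have "ln 2 + r * k * ln (real r) \<le> S * ln (1 + \<epsilon>) + ln (card V)"
    using ln_card Gamma_le ln_2_less_1 u_eqs(1) by linarith
  then have "ln (2 * real r ^ (r * k)) \<le> ln ((1 + \<epsilon>) ^ S * card V)"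
    using r_ge e card_pos by (simp add: ln_mult ln_realpow)
  then show ?thesis using r_ge e card_pos by (subst (asm) ln_le_cancel_iff) auto
qed

text \<open>Since ln r \<ge> l/2 and S \<le> r k/8, the logarithm of the quotient is at least 7/16
  of r k l minus \<Gamma> + 1, and \<Gamma> and 1 are each at most r k/16.\<close>

lemma large: "exp (real r * k * l / 4) \<le> card V / real r ^ S"
proof -
  define R where "R = real r * k"
  have R: "16 \<le> R"
  proof -
    have "16 * 1 * 1 \<le> 2 ^ 70 * real r ^ 2 * l ^ 6"
      using r_ge l_ge by (intro mult_mono one_le_power) auto
    then have "16 \<le> real k" using k by linarith
    then show ?thesis unfolding R_def using mult_mono[of 1 "real r" 16 "real k"] r_ge by simp
  qed
  have Rl: "R * 1 \<le> R * l" using l_ge R by (intro mult_left_mono) auto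
  have "1 * real k \<le> R" unfolding R_def using r_ge by (intro mult_right_mono) auto
  moreover have "8 * real S \<le> real k" using S_bounds(1) rt_le_k by simp
  ultimately have S: "real S \<le> R / 8" "\<Gamma> \<le> R / 16" using Gamma_le(3) by linarith+
  have "R * (7 / 8) * (l / 2) \<le> (R - S) * ln (real r)"
    using S R ln_r l_ge by (intro mult_mono) auto
  then have "R * l * (7 / 16) \<le> R * ln (real r) - S * ln (real r)"
    by (simp add: algebra_simps)
  moreover have "R \<le> R * l" using Rl by simp
  ultimately have "R * l / 4 \<le> R * ln (real r) - \<Gamma> - 1 - S * ln (real r)"
    using S R by linarith
  also have "\<dots> \<le> ln (card V) - S * ln (real r)" using ln_card by (simp add: R_def)
  also have "\<dots> = ln (card V / real r ^ S)" using r_ge card_pos by (simp add: ln_div ln_realpow)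
  finally have "R * l / 4 \<le> ln (card V / real r ^ S)" .
  then show ?thesis using r_ge card_pos unfolding R_def by (subst (asm) ln_ge_iff) auto
qed

text \<open>The page set falls short of its ideal size by 256u from the deviation \<eta> over
  \<open>t\<close> steps and by 128u from the boosts. With the at most u for \<Gamma> and constants,
  this is far below the 2048u gained from the tilted weights.\<close>

lemma gain:
  assumes "real b * ln (1 + 2 ^ s0 / real t) \<le> ln (9 / \<delta>)"
  shows "2 * real r ^ (r * k) * (1 / (1 - \<theta>)) ^ (k - t)
    \<le> (p0 - \<delta>) ^ (t + b) * real r ^ t * (1 + \<theta> / (real r - 1)) ^ ((r - 1) * k - S) * card V"
proof -
  define q where "q = p0 - \<delta>"
  define g where "g = 1 + \<theta> / (real r - 1)"
  have q: "0 < q" using delta by (simp add: q_def)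
  have r1: "1 \<le> real r - 1" using r_ge by simp
  have g: "0 < g" using theta r1 by (auto simp: g_def intro!: add_pos_nonneg)
  have e1: "real (k - t) = real k - t" using S_bounds(3) by (simp add: of_nat_diff)
  have "1 * k \<le> (r - 1) * k" using r by (intro mult_right_mono) auto
  then have "S \<le> (r - 1) * k" using S_bounds(3) by linarith
  then have e2: "real ((r - 1) * k - S) = (real r - 1) * k - S" using r by (simp add: of_nat_diff)
  have "t * - ln q \<le> t * (ln (real r) + 4 * \<eta>)" using ln_p(1) unfolding q_def by (intro mult_left_mono) auto
  then have A: "t * - ln q \<le> t * ln (real r) + 256 * u" using u_eqs(3) by (simp add: algebra_simps)
  have "b * - ln q \<le> b * l" using ln_p(2) unfolding q_def by (intro mult_left_mono) auto
  then have B: "b * - ln q \<le> 128 * u" using boost_count[OF assms] by linarith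
  define m n where "m = k - t" and "n = (r - 1) * k - S"
  have "ln 2 + r * k * ln (real r) + m * - ln (1 - \<theta>)
      \<le> (t * ln q + b * ln q) + t * ln (real r) + n * ln g + ln (card V)"
    using A B weight_gain ln_card Gamma_le ln_2_less_1 u_eqs(1) unfolding g_def m_def n_def e1 e2 by linarith
  then have "ln (2 * real r ^ (r * k) * (1 / (1 - \<theta>)) ^ m)
      \<le> ln (q ^ (t + b) * real r ^ t * g ^ n * card V)"
    using r_ge theta q g card_pos
    by (simp add: ln_mult ln_realpow ln_div algebra_simps)
  then show ?thesis
    using r_ge theta q g card_pos
    unfolding q_def[symmetric] g_def[symmetric] m_def[symmetric] n_def[symmetric]
    by (subst (asm) ln_le_cancel_iff) auto
qed

lemma has_clique_parameters:
  assumes "\<And>x y. c x y = c y x" "\<And>x y. c x y < r"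
  shows "has_clique c r V (\<lambda>_. k)"
proof (rule has_clique_of_parameters[where \<epsilon> = \<epsilon> and \<delta> = \<delta> and \<theta> = \<theta> and S = S and t = t
      and kk = kk and ?s0.0 = s0 and G = "real k / 256" and w = "card V / real r ^ S", OF assms r V])
  show "0 < \<epsilon>" using eta r_ge by (simp add: \<epsilon>_def)
  show "2 \<le> t" using t_ge by simp
  show "card V / real r ^ S * real r ^ S \<le> card V" using r_ge by simp
  have "real r * k * l / 4 \<le> exp (real r * k * l / 4)"
    using exp_ge_add_one_self[of "real r * k * l / 4"] by linarith
  then show "real r / \<epsilon> \<le> card V / real r ^ S" using r_div_epsilon large by linarith
  have "exp ((ln (2 * real r) + real (3 * kk * r * (s0 + 2)\<^sup>2) * ln 2) * (real r * real t)
      + real k / 256 * (real r * ln (9 / \<delta>))) \<le> exp (real r * k * l / 4)"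
    using size_exponent by simp
  with large show "exp ((ln (2 * real r) + real (3 * kk * r * (s0 + 2)\<^sup>2) * ln 2) * (real r * real t)
      + real k / 256 * (real r * ln (9 / \<delta>))) \<le> card V / real r ^ S" by linarith
qed (use theta many S_bounds(3) kk_bounds(1) delta(1,2)[unfolded p0_def] cost gain[unfolded p0_def] in auto)

end

end


theorem theorem1p1:
  shows "\<exists>c K :: real. c > 0 \<and> K > 0 \<and>
    (\<forall>r k :: nat. r \<ge> 2 \<longrightarrow> k \<ge> 2 \<longrightarrow>
       real k \<ge> K * real r ^ 2 * ln (2 * real r) ^ 6 \<longrightarrow>
       real (ramsey_number r k)
         \<le> exp (- c * (real k / (real r ^ 2 * ln (2 * real r) ^ 4))) * real r ^ (r * k))"
proof -
  have main: "real (ramsey_number r k)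
      \<le> exp (- (1 / 2 ^ 67) * (real k / (real r ^ 2 * ln (2 * real r) ^ 4))) * real r ^ (r * k)"
    if r: "2 \<le> r" and k: "2 ^ 70 * real r ^ 2 * ln (2 * real r) ^ 6 \<le> real k" for r k :: nat
  proof -
    define l where "l = ln (2 * real r)"
    interpret ramsey_parameters r k l
      by unfold_locales (use r k in \<open>simp_all add: l_def\<close>)
    define N where "N = exp (- \<Gamma>) * real r ^ (r * k)"
    define n where "n = nat \<lfloor>N\<rfloor>"
    have "0 \<le> r * k * ln (real r) - \<Gamma>"
    proof -
      have "\<Gamma> \<le> real k / 2" using Gamma_le(3) k_pos by linarith
      also have "\<dots> \<le> real k * (real r * (l / 2))"
        using r_ge l_ge mult_mono[of 1 "real r" 1 l] k_pos by simp
      also have "\<dots> \<le> real k * (real r * ln (real r))"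
        using ln_r by (intro mult_left_mono) auto
      finally show ?thesis by (simp add: ac_simps)
    qed
    then have "1 \<le> exp (r * k * ln (real r) - \<Gamma>)" by simp
    also have "\<dots> = N" unfolding N_def using r_ge
      by (simp add: exp_diff exp_minus field_simps flip: powr_realpow add: powr_def)
    finally have N: "1 \<le> N" .
    have fl: "1 \<le> \<lfloor>N\<rfloor>" using N by simp
    then have "real n = real_of_int \<lfloor>N\<rfloor>" by (simp add: n_def)
    then have n: "real n \<le> N" "N \<le> 2 * real n" using fl by linarith+
    have "partn {..<n} k 2 {..<r}"
      unfolding partn_def
    proof (intro ballI)
      fix f assume f: "f \<in> [{..<n}]\<^bsup>2\<^esup> \<rightarrow> {..<r}"
      \<comment> \<open>The book argument wants a symmetric function with values below
        \<open>r\<close> at all arguments, so colour 0 fills the diagonal and everything outside the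
        vertex set.\<close>
      define c where "c x y = (if x \<noteq> y \<and> x < n \<and> y < n then f {x, y} else 0)" for x y
      have f_less: "f {x, y} < r" if "x \<noteq> y" "x < n" "y < n" for x y
        using f that by (auto simp: nsets_def Pi_iff)
      have "has_clique c r {..<n} (\<lambda>_. k)"
      proof (rule has_clique_parameters)
        show "exp (- \<Gamma>) * real r ^ (r * k) \<le> 2 * card {..<n}" using n by (simp add: N_def)
        show "c x y = c y x" for x y by (auto simp: c_def insert_commute)
        show "c x y < r" for x y using f_less r by (auto simp: c_def)
      qed simp
      then obtain i H where i: "i < r" and H: "H \<subseteq> {..<n}" "finite H" "card H = k" "mono_clique c i H"
        by (auto simp: has_clique_def)
      have "f ` [H]\<^bsup>2\<^esup> \<subseteq> {i}"
      proof
        fix z assume "z \<in> f ` [H]\<^bsup>2\<^esup>"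
        then obtain e where e: "z = f e" "e \<subseteq> H" "card e = 2" by (auto simp: nsets_def)
        then obtain x y where xy: "e = {x, y}" "x \<noteq> y" by (auto simp: card_2_iff)
        then have xyH: "x \<in> H" "y \<in> H" "x < n" "y < n" using e H(1) by auto
        then have "c x y = i" using H(4) xy(2) by (simp add: mono_clique_def)
        moreover have "c x y = f e" using xyH xy by (simp add: c_def)
        ultimately have "f e = i" by simp
        then show "z \<in> {i}" using e by simp
      qed
      moreover have "H \<in> [{..<n}]\<^bsup>k\<^esup>" using H by (simp add: nsets_def)
      ultimately show "\<exists>\<xi>\<in>{..<r}. monochromatic {..<n} k 2 f \<xi>"
        unfolding monochromatic_def using i by blast
    qed
    then have "ramsey_number r k \<le> n" by (simp add: ramsey_number_le_iff)
    then have "real (ramsey_number r k) \<le> N" using n by linarith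
    then show ?thesis unfolding N_def \<Gamma>_def l_def[symmetric] by simp
  qed
  show ?thesis
    by (rule exI[of _ "1 / 2 ^ 67"], rule exI[of _ "2 ^ 70"]) (use main in simp)
qed

end
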